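(* Let $\mu,\nu$ be Borel probability measures on $\mathbb{R}$ with finite first moment, and let $q$ be a Borel probability measure on $\mathbb{R}$ that is absolutely continuous with respect to Lebesgue measure. If the pair $(\mu,\nu)$ is irreducible and $\mu$ is supported on finitely many atoms, then there exists a $q$-Bass martingale from $\mu$ to $\nu$.
   Context: Notation. For a Borel probability measure $\xi$ on $\mathbb{R}$, $F_\xi$ is its cumulative distribution function and $Q_\xi(u)=\inf\{y\in\mathbb{R}:F_\xi(y)\ge u\}$, $u\in(0,1)$, its left-continuous quantile function, extended by $Q_\xi(0)=\inf(\mathrm{supp}(\xi))$, $Q_\xi(1)=\sup(\mathrm{supp}(\xi))$. $\alpha\ast q$ denotes the convolution of the measures $\alpha$ and $q$, and for a measurable function $T$, $(q\star T)(x)=\int_{\mathbb{R}}T(x+y)\,q(dy)$. $\mathscr{M}(\mu,\nu)$ is the set of martingale couplings of $\mu$ and $\nu$, i.e. probability measures $\pi(dx,dy)=\mu(dx)\pi_x(dy)$ on $\mathbb{R}^2$ with first marginal $\mu$, second marginal $\nu$ and $\int y\,\pi_x(dy)=x$ for $\mu$-a.e. $x$. $q$-Bass martingale. A measure $\pi\in\mathscr{M}(\mu,\nu)$ is called a $q$-Bass martingale (from $\mu$ to $\nu$) if there is a Borel probability measure $\alpha$ on $\mathbb{R}$ (called a Bass measure) such that, with $T=Q_\nu\circ F_{\alpha\ast q}$ and $X_0\sim\alpha$, $Y\sim q$ independent, $\pi$ is the law of $(M_0,M_1)$ where $M_0=(q\star T)(X_0)$, $M_1=T(X_0+Y)$,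 and $q\star T$ is increasing $\alpha$-a.s., meaning strictly increasing on a Borel set of full $\alpha$-measure. (The function $q\star T$ is defined $\alpha$-a.e.) Irreducibility. $\mu\preceq_c\nu$ (convex order) means $\int\varphi\,d\mu\le\int\varphi\,d\nu$ for every convex $\varphi:\mathbb{R}\to\mathbb{R}$ for which both integrals are well-defined. For $\rho$ with finite first moment let $C_\rho(x)=\int_{\mathbb{R}}(y-x)^+\rho(dy)$. The pair $(\mu,\nu)$ is irreducible if $\mu\preceq_c\nu$ and the set $I=\{x\in\mathbb{R}:C_\mu(x)<C_\nu(x)\}$ is an interval with $\mu(I)=1$. *)

theory Defs
  imports "HOL-Probability.Probability"
begin

definition measure_support :: "real measure \<Rightarrow> real set" where
  "measure_support \<xi> = {x. \<forall>U. open U \<longrightarrow> x \<in> U \<longrightarrow> emeasure \<xi> U > 0}"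

(* Extended-real valued, because the endpoint values, the infimum and supremum of the
   support, may be infinite; only arguments in [0,1] are meaningful. *)
definition quantile :: "real measure \<Rightarrow> real \<Rightarrow> ereal" where
  "quantile \<xi> u =
     (if u = 0 then (INF x\<in>measure_support \<xi>. ereal x)
      else if u = 1 then (SUP x\<in>measure_support \<xi>. ereal x)
      else (INF y\<in>{y. u \<le> cdf \<xi> y}. ereal y))"

definition martingale_couplings :: "real measure \<Rightarrow> real measure \<Rightarrow> (real \<times> real) measure set" where
  "martingale_couplings \<mu> \<nu> =
     {\<pi>. prob_space \<pi> \<and> sets \<pi> = sets (borel \<Otimes>\<^sub>M borel) \<and>
         distr \<pi> borel fst = \<mu> \<and> distr \<pi> borel snd = \<nu> \<and>
         (\<exists>K. K \<in> borel \<rightarrow>\<^sub>M prob_algebra borel \<and>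
              (\<forall>A\<in>sets borel. \<forall>B\<in>sets borel.
                 emeasure \<pi> (A \<times> B) = (\<integral>\<^sup>+x\<in>A. emeasure (K x) B \<partial>\<mu>)) \<and>
              (AE x in \<mu>. integrable (K x) (\<lambda>y. y) \<and> (\<integral>y. y \<partial>K x) = x))}"

(* The function written q * T in the literature (star product of a measure and a function),
   for extended-real valued T. It is meaningful only where bass_avg_defined holds:
   elsewhere real_of_ereal or the Bochner integral returns a default value. *)
definition bass_avg :: "real measure \<Rightarrow> (real \<Rightarrow> ereal) \<Rightarrow> real \<Rightarrow> real" where
  "bass_avg q T x = (\<integral>y. real_of_ereal (T (x + y)) \<partial>q)"

definition bass_avg_defined :: "real measure \<Rightarrow> (real \<Rightarrow> ereal) \<Rightarrow> real \<Rightarrow> bool" where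
  "bass_avg_defined q T x \<longleftrightarrow>
     (AE y in q. \<bar>T (x + y)\<bar> \<noteq> \<infinity>) \<and> integrable q (\<lambda>y. real_of_ereal (T (x + y)))"

definition bass_map :: "real measure \<Rightarrow> real measure \<Rightarrow> real measure \<Rightarrow> real \<Rightarrow> ereal" where
  "bass_map q \<nu> \<alpha> = quantile \<nu> \<circ> cdf (\<alpha> \<star> q)"

(* The independent pair (X0, Y) is realized as the coordinates of the product of alpha and q.
   The full-measure set A on which the average is strictly increasing is taken inside the
   domain of definition of that average, which is presupposed to have full alpha-measure;
   in particular M1 is almost surely finite. *)
definition bass_measure ::
  "real measure \<Rightarrow> real measure \<Rightarrow> (real \<times> real) measure \<Rightarrow> real measure \<Rightarrow> bool" where
  "bass_measure q \<nu> \<pi> \<alpha> \<longleftrightarrow>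
     real_distribution \<alpha> \<and>
     \<pi> = distr (\<alpha> \<Otimes>\<^sub>M q) (borel \<Otimes>\<^sub>M borel)
           (\<lambda>(x, y). (bass_avg q (bass_map q \<nu> \<alpha>) x, real_of_ereal (bass_map q \<nu> \<alpha> (x + y)))) \<and>
     (\<exists>A\<in>sets borel. measure \<alpha> A = 1 \<and>
        (\<forall>x\<in>A. bass_avg_defined q (bass_map q \<nu> \<alpha>) x) \<and>
        strict_mono_on A (bass_avg q (bass_map q \<nu> \<alpha>)))"

definition q_bass_martingale ::
  "real measure \<Rightarrow> real measure \<Rightarrow> real measure \<Rightarrow> (real \<times> real) measure \<Rightarrow> bool" where
  "q_bass_martingale q \<mu> \<nu> \<pi> \<longleftrightarrow>
     \<pi> \<in> martingale_couplings \<mu> \<nu> \<and> (\<exists>\<alpha>. bass_measure q \<nu> \<pi> \<alpha>)"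

(* The integral of f as an extended real number is well defined if its positive or its
   negative part has finite integral. Note that ennreal truncates negative numbers to 0. *)
definition ext_integral_defined :: "'a measure \<Rightarrow> ('a \<Rightarrow> real) \<Rightarrow> bool" where
  "ext_integral_defined M f \<longleftrightarrow>
     (\<integral>\<^sup>+x. ennreal (f x) \<partial>M) < \<infinity> \<or> (\<integral>\<^sup>+x. ennreal (- f x) \<partial>M) < \<infinity>"

definition ext_integral :: "'a measure \<Rightarrow> ('a \<Rightarrow> real) \<Rightarrow> ereal" where
  "ext_integral M f =
     enn2ereal (\<integral>\<^sup>+x. ennreal (f x) \<partial>M) - enn2ereal (\<integral>\<^sup>+x. ennreal (- f x) \<partial>M)"

definition convex_order :: "real measure \<Rightarrow> real measure \<Rightarrow> bool" where
  "convex_order \<mu> \<nu> \<longleftrightarrow>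
     (\<forall>\<phi>. convex_on UNIV \<phi> \<longrightarrow> ext_integral_defined \<mu> \<phi> \<longrightarrow> ext_integral_defined \<nu> \<phi> \<longrightarrow>
          ext_integral \<mu> \<phi> \<le> ext_integral \<nu> \<phi>)"

definition call_potential :: "real measure \<Rightarrow> real \<Rightarrow> real" where
  "call_potential \<rho> x = (\<integral>y. max (y - x) 0 \<partial>\<rho>)"

definition irreducible_pair :: "real measure \<Rightarrow> real measure \<Rightarrow> bool" where
  "irreducible_pair \<mu> \<nu> \<longleftrightarrow>
     convex_order \<mu> \<nu> \<and>
     is_interval {x. call_potential \<mu> x < call_potential \<nu> x} \<and>
     measure \<mu> {x. call_potential \<mu> x < call_potential \<nu> x} = 1"

end

theory Submission
  imports Defs
begin

text \<open>
  Write \<open>\<mu> = \<Sum>s\<in>S. p s \<delta>\<^sub>s\<close>. A Bass measure is sought among the measures that move each atom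
  \<open>s\<close> to a new position \<open>a s\<close> without changing its mass: \<open>\<alpha> = \<Sum>s\<in>S. p s \<delta>\<^bsub>a s\<^esub>\<close>. Let
  \<open>X \<sim> \<alpha>\<close> and \<open>Y \<sim> q\<close> be independent, let \<open>F\<close> be the distribution function of \<open>X + Y\<close>, that is of
  \<open>\<alpha> \<star> q\<close>, and let \<open>T = Q\<^sub>\<nu> \<circ> F\<close>. Since \<open>q\<close> has no atoms, \<open>F\<close> is continuous,
  so \<open>F (X + Y)\<close> is uniform and \<open>T (X + Y)\<close> has law \<open>\<nu>\<close> whatever \<open>a\<close> is. What remains is to choose
  \<open>a\<close> with \<open>avg a s = s\<close> for every atom, where \<open>avg a s = E (T (a s + Y))\<close>. Strict monotonicity
  of the averages on the new positions is then automatic: \<open>T\<close> is increasing and the values \<open>s\<close> are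
  distinct.

  The finite system \<open>avg a s = s\<close> is solved by an order argument. Because
  \<open>F (a s + y) = \<Sum>t\<in>S. p t G (a s - a t + y)\<close>, with \<open>G\<close> the distribution function of \<open>q\<close>, the
  value \<open>avg a s\<close> decreases when any other coordinate \<open>a t\<close> increases, and it depends continuously on
  \<open>a\<close>. For such maps the largest \<open>a\<close> in a box \<open>[0, L]\<^sup>S\<close> with \<open>avg a s \<le> s\<close> (wherever \<open>a s > 0\<close>) exists
  and solves the complementarity problem: equality \<open>avg a s = s\<close> holds except that \<open>avg a s > s\<close> may
  occur where \<open>a s = 0\<close> and \<open>avg a s < s\<close> where \<open>a s = L\<close> (\<open>box_complementarity\<close>).

  Irreducibility excludes that a solution touches both faces when \<open>L\<close> is large. If it did, the
  positions would split, across a wide gap, into an upper part \<open>B\<close> and a lower part. Across a wide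
  gap, \<open>B\<close> receives essentially the top slice of \<open>\<nu>\<close> of mass \<open>p(B)\<close>, and irreducibility says that
  the first moment of this slice is strictly larger than \<open>\<Sum>s\<in>B. p s * s\<close>
  (\<open>separated_avg_too_large\<close>), whereas \<open>avg a s \<le> s\<close> on \<open>B\<close>. So one of the faces is not
  touched, the differences \<open>avg a s - s\<close> all have the same sign, and since \<open>\<mu>\<close> and \<open>\<nu>\<close> have the
  same mean they all vanish.
\<close>

section \<open>Quantile functions and the uniform law\<close>

text \<open>
  On \<open>(0, 1)\<close> this is the generalised inverse of the distribution function. Taking the real part of the
  extended-real quantile everywhere makes it agree with the integrand of \<^const>\<open>bass_avg\<close> on the nose,
  also at the endpoints, where the quantile may be infinite.
\<close>

definition quant :: "real measure \<Rightarrow> real \<Rightarrow> real" where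
  "quant \<xi> u = real_of_ereal (quantile \<xi> u)"

context cdf_distribution
begin

lemma ereal_Inf_quantile:
  assumes "0 < u" "u < 1"
  shows "quantile M u = ereal (I u)"
proof -
  obtain y where y: "u \<le> C y"
    using order_tendstoD(1)[OF top assms(2)]
    by (auto dest!: eventually_happens'[OF trivial_limit_at_top_linorder] intro: less_imp_le)
  have "bdd_below {x. u \<le> C x}"
    by (rule bdd_belowI[of _ "I u"]) (rule iffD1[OF pseudoinverse[OF assms]], rule CollectD)
  then have "ereal (I u) = (INF a\<in>{x. u \<le> C x}. ereal a)"
    using y by (intro ereal_Inf') auto
  then show ?thesis using assms by (simp add: quantile_def)
qed

lemma quant_eq_I: "0 < u \<Longrightarrow> u < 1 \<Longrightarrow> quant M u = I u"
  by (simp add: quant_def ereal_Inf_quantile)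

lemma quantile_eq_quant: "0 < u \<Longrightarrow> u < 1 \<Longrightarrow> quantile M u = ereal (quant M u)"
  by (simp add: quant_def ereal_Inf_quantile)

lemma quant_mono: "0 < u \<Longrightarrow> u \<le> v \<Longrightarrow> v < 1 \<Longrightarrow> quant M u \<le> quant M v"
  using mono_I by (auto simp: quant_eq_I mono_on_def)

text \<open>
  Outside \<open>[0, 1]\<close> the infimum in \<^const>\<open>quantile\<close> is infinite, and its real part is the default \<open>0\<close>.
\<close>

lemma quant_outside: "u < 0 \<or> 1 < u \<Longrightarrow> quant M u = 0"
proof (elim disjE)
  assume u: "u < 0"
  have "{y. u \<le> C y} = UNIV"
    using u cdf_nonneg by (auto intro: order_trans[of _ 0])
  moreover have "(INF y. ereal y) = - \<infinity>"
    by (metis INF_lower UNIV_I ereal_bot uminus_ereal.simps(2))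
  ultimately show ?thesis using u by (simp add: quant_def quantile_def)
next
  assume u: "1 < u"
  then have "{y. u \<le> C y} = {}"
    using cdf_bounded_prob by (auto simp: not_le intro: le_less_trans)
  then show ?thesis using u by (simp add: quant_def quantile_def top_ereal_def)
qed

lemma measurable_quant [measurable]: "quant M \<in> borel_measurable borel"
proof -
  have "(\<lambda>u. I u * indicator {0<..<1} u) \<in> borel_measurable borel"
    using measurable_CI by (subst (asm) borel_measurable_restrict_space_iff) (auto simp: mult.commute)
  then have "(\<lambda>u. I u * indicator {0<..<1} u + quant M 0 * indicator {0} u + quant M 1 * indicator {1} u)
      \<in> borel_measurable borel"
    by measurable
  also have "(\<lambda>u. I u * indicator {0<..<1} u + quant M 0 * indicator {0} u + quant M 1 * indicator {1} u)
      = quant M"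
  proof
    fix u :: real
    show "I u * indicator {0<..<1} u + quant M 0 * indicator {0} u + quant M 1 * indicator {1} u = quant M u"
      using quant_eq_I[of u] quant_outside[of u]
      by (cases "0 < u \<and> u < 1"; cases "u = 0"; cases "u = 1") (auto simp: indicator_def)
  qed
  finally show ?thesis .
qed

lemma distr_quant: "distr (restrict_space lborel {0<..<1}) borel (quant M) = M"
proof -
  have "distr (restrict_space lborel {0<..<1}) borel (quant M) = distr (restrict_space lborel {0<..<1}) borel I"
    by (intro distr_cong) (auto simp: quant_eq_I space_restrict_space)
  then show ?thesis by (simp add: distr_I_eq_M)
qed

text \<open>
  The measure is the law of \<open>I U\<close> with \<open>U\<close> uniform, and for a continuous distribution function \<open>I\<close> is
  a genuine right inverse of it, so that \<open>C (I U) = U\<close>.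
\<close>

lemma distr_cdf_of_continuous:
  assumes "\<And>x. isCont C x"
  shows "distr M borel C = distr (restrict_space lborel {0<..<1}) borel (\<lambda>u. u)"
proof -
  have CI: "C (I u) = u" if u: "0 < u" "u < 1" for u
  proof (rule antisym)
    show "u \<le> C (I u)" by (rule iffD2[OF pseudoinverse[OF u] order_refl])
    \<comment> \<open>If \<open>C\<close> exceeded \<open>u\<close> at \<open>I u\<close>, continuity would make it exceed \<open>u\<close> slightly to the left,
      against the minimality of \<open>I u\<close>.\<close>
    show "C (I u) \<le> u"
    proof (rule ccontr)
      assume "\<not> C (I u) \<le> u"
      then have "\<forall>\<^sub>F x in at_left (I u). u < C x"
        using assms[of "I u"] by (intro order_tendstoD(1)[of C "C (I u)"])
          (auto simp: isCont_def intro: tendsto_within_subset)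
      moreover have "\<forall>\<^sub>F x in at_left (I u). x < I u"
        by (simp add: eventually_at_filter)
      ultimately have "\<forall>\<^sub>F x in at_left (I u). False"
      proof eventually_elim
        case (elim x)
        then have "I u \<le> x" by (intro iffD1[OF pseudoinverse[OF u]]) simp
        then show ?case using elim(2) by simp
      qed
      then show False by simp
    qed
  qed
  have "distr M borel C = distr (distr (restrict_space lborel {0<..<1}) borel I) borel C"
    by (simp add: distr_I_eq_M)
  also have "\<dots> = distr (restrict_space lborel {0<..<1}) borel (C \<circ> I)"
    by (rule distr_distr) auto
  also have "\<dots> = distr (restrict_space lborel {0<..<1}) borel (\<lambda>u. u)"
    by (rule distr_cong) (auto simp: space_restrict_space CI)
  finally show ?thesis .
qed

end

text \<open>
  The monotone transport from an atomless measure to \<open>\<nu>\<close>: uniform law first, then the quantile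
  transform.
\<close>

lemma distr_quant_cdf:
  assumes "real_distribution \<nu>" "real_distribution \<rho>" "\<And>x. isCont (cdf \<rho>) x"
  shows "distr \<rho> borel (\<lambda>z. quant \<nu> (cdf \<rho> z)) = \<nu>"
proof -
  interpret \<nu>: cdf_distribution \<nu> using assms(1) by (simp add: cdf_distribution_def)
  interpret \<rho>: cdf_distribution \<rho> using assms(2) by (simp add: cdf_distribution_def)
  have "distr \<rho> borel (\<lambda>z. quant \<nu> (cdf \<rho> z)) = distr (distr \<rho> borel (cdf \<rho>)) borel (quant \<nu>)"
    by (subst distr_distr) (auto simp: o_def)
  also have "\<dots> = distr (distr (restrict_space lborel {0<..<1}) borel (\<lambda>u. u)) borel (quant \<nu>)"
    by (simp add: \<rho>.distr_cdf_of_continuous[OF assms(3)])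
  also have "\<dots> = distr (restrict_space lborel {0<..<1}) borel (quant \<nu> \<circ> (\<lambda>u. u))"
    by (rule distr_distr) (auto intro: measurable_restrict_space1)
  also have "\<dots> = \<nu>"
    by (simp add: o_def \<nu>.distr_quant)
  finally show ?thesis .
qed

text \<open>
  Exceptional Lebesgue null sets of levels are invisible for the random level \<open>F\<^sub>\<rho>(Z)\<close>. This serves for
  the endpoints \<open>0\<close> and \<open>1\<close> and for the jumps of the quantile function.
\<close>

lemma AE_cdf_of_continuous:
  assumes "real_distribution \<rho>" "\<And>x. isCont (cdf \<rho>) x"
    and "AE u in lborel. 0 < u \<longrightarrow> u < 1 \<longrightarrow> P u"
  shows "AE z in \<rho>. 0 < cdf \<rho> z \<and> cdf \<rho> z < 1 \<and> P (cdf \<rho> z)"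
proof -
  interpret \<rho>: cdf_distribution \<rho> using assms(1) by (simp add: cdf_distribution_def)
  obtain N where N: "N \<in> null_sets lborel" "{u. \<not> (0 < u \<longrightarrow> u < 1 \<longrightarrow> P u)} \<subseteq> N"
    using assms(3) by (auto simp: eventually_ae_filter)
  have [measurable]: "N \<in> sets borel" using N(1) by auto
  have "AE u in lborel. 0 < u \<longrightarrow> u < 1 \<longrightarrow> u \<notin> N"
    using N(1) by (auto dest: AE_not_in)
  then have "AE u in restrict_space lborel {0<..<1}. 0 < u \<and> u < 1 \<and> u \<notin> N"
    by (subst AE_restrict_space_iff) auto
  then have "AE u in distr (restrict_space lborel {0<..<1}) borel (\<lambda>u. u). 0 < u \<and> u < 1 \<and> u \<notin> N"
    by (subst AE_distr_iff) (auto intro: measurable_restrict_space1)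
  then have "AE u in distr \<rho> borel (cdf \<rho>). 0 < u \<and> u < 1 \<and> u \<notin> N"
    by (simp only: \<rho>.distr_cdf_of_continuous[OF assms(2)])
  then have "AE z in \<rho>. 0 < cdf \<rho> z \<and> cdf \<rho> z < 1 \<and> cdf \<rho> z \<notin> N"
    by (rule AE_distrD[rotated]) auto
  then show ?thesis
    by eventually_elim (use N(2) in auto)
qed

section \<open>A complementarity problem on a box\<close>

text \<open>
  The set \<open>P\<close> of subsolutions is closed under pointwise maxima: where the maximum is attained by
  \<open>b\<close>, the other coordinates have only gone up, which lowers \<open>e\<close>. Hence its coordinatewise supremum
  \<open>s\<close> is a limit of elements of \<open>P\<close> and, by continuity, lies in \<open>P\<close> itself. If \<open>e s i < x i\<close> held with
  \<open>s i < L\<close>, a small increase of \<open>s i\<close> alone would keep the \<open>i\<close>-th inequality by continuity and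
  would only lower the other values of \<open>e\<close>, so \<open>s\<close> would not be the supremum.
\<close>

lemma box_complementarity:
  fixes e :: "('i \<Rightarrow> real) \<Rightarrow> 'i \<Rightarrow> real" and x :: "'i \<Rightarrow> real"
  assumes fin: "finite S" and L: "0 \<le> L"
    and anti: "\<And>a b i. i \<in> S \<Longrightarrow> a i = b i \<Longrightarrow> (\<And>j. j \<in> S \<Longrightarrow> a j \<le> b j) \<Longrightarrow> e b i \<le> e a i"
    and cont: "\<And>a b i. i \<in> S \<Longrightarrow> (\<And>j. j \<in> S \<Longrightarrow> (\<lambda>n::nat. a n j) \<longlonglongrightarrow> b j) \<Longrightarrow>
        (\<lambda>n. e (a n) i) \<longlonglongrightarrow> e b i"
  obtains a where "\<And>i. i \<in> S \<Longrightarrow> 0 \<le> a i" "\<And>i. i \<in> S \<Longrightarrow> a i \<le> L"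
    "\<And>i. i \<in> S \<Longrightarrow> 0 < a i \<Longrightarrow> e a i \<le> x i" "\<And>i. i \<in> S \<Longrightarrow> a i < L \<Longrightarrow> x i \<le> e a i"
proof -
  define P where "P = {a. \<forall>i\<in>S. 0 \<le> a i \<and> a i \<le> L \<and> (0 < a i \<longrightarrow> e a i \<le> x i)}"
  define s where "s i = (SUP a\<in>P. a i)" for i
  have P0: "(\<lambda>_. 0) \<in> P" using L by (auto simp: P_def)
  have bdd: "bdd_above ((\<lambda>a. a i) ` P)" if "i \<in> S" for i
    using that by (auto simp: P_def intro!: bdd_aboveI2[of _ _ L])
  have s_upper: "a i \<le> s i" if "a \<in> P" "i \<in> S" for a i
    unfolding s_def using that by (intro cSUP_upper bdd)
  have s_nonneg: "0 \<le> s i" if "i \<in> S" for i using s_upper[OF P0 that] .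
  have s_le: "s i \<le> L" if "i \<in> S" for i
    unfolding s_def using P0 that by (intro cSUP_least) (auto simp: P_def)
  \<comment> \<open>One element of \<open>P\<close> that is close to the supremum in all coordinates at once: the maximum of
    elements that are close in one coordinate each.\<close>
  have "\<exists>c\<in>P. \<forall>i\<in>S. s i - inverse (Suc n) < c i" for n :: nat
  proof (cases "S = {}")
    case True then show ?thesis using P0 by auto
  next
    case False
    have "\<exists>b\<in>P. s i - inverse (Suc n) < b i" if "i \<in> S" for i
      using less_cSUP_iff[OF _ bdd[OF that], of "s i - inverse (Suc n)"] P0
      unfolding s_def by auto
    then obtain b where b: "\<And>i. i \<in> S \<Longrightarrow> b i \<in> P" "\<And>i. i \<in> S \<Longrightarrow> s i - inverse (Suc n) < b i i"
      by metis
    define c where "c j = Max ((\<lambda>i. b i j) ` S)" for j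
    have c_ge: "b i j \<le> c j" if "i \<in> S" for i j
      unfolding c_def using that fin by (intro Max_ge) auto
    have c_att: "\<exists>i\<in>S. c j = b i j" for j
    proof -
      have "c j \<in> (\<lambda>i. b i j) ` S"
        unfolding c_def using fin False by (intro Max_in) auto
      then show ?thesis by auto
    qed
    have "c \<in> P"
      unfolding P_def
    proof (intro CollectI ballI)
      fix j assume j: "j \<in> S"
      obtain i where i: "i \<in> S" "c j = b i j" using c_att by blast
      have "e c j \<le> e (b i) j" using j i c_ge by (intro anti) auto
      then show "0 \<le> c j \<and> c j \<le> L \<and> (0 < c j \<longrightarrow> e c j \<le> x j)"
        using b(1)[OF i(1)] j i(2) by (auto simp: P_def)
    qed
    moreover have "\<forall>i\<in>S. s i - inverse (Suc n) < c i"
      using b(2) c_ge by (meson less_le_trans)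
    ultimately show ?thesis by blast
  qed
  then obtain c where c: "\<And>n. c n \<in> P" "\<And>n i. i \<in> S \<Longrightarrow> s i - inverse (real (Suc n)) < c n i"
    by metis
  have c_lim: "(\<lambda>n. c n i) \<longlonglongrightarrow> s i" if i: "i \<in> S" for i
  proof (rule tendsto_sandwich)
    show "(\<lambda>n. s i - inverse (real (Suc n))) \<longlonglongrightarrow> s i"
      using tendsto_diff[OF tendsto_const LIMSEQ_inverse_real_of_nat, of "s i"] by simp
    show "\<forall>\<^sub>F n in sequentially. s i - inverse (real (Suc n)) \<le> c n i"
      by (intro always_eventually allI less_imp_le c(2)[OF i])
    show "\<forall>\<^sub>F n in sequentially. c n i \<le> s i"
      using s_upper c(1) i by auto
  qed simp
  have s_sub: "e s i \<le> x i" if i: "i \<in> S" "0 < s i" for i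
  proof (rule LIMSEQ_le_const2)
    show "(\<lambda>n. e (c n) i) \<longlonglongrightarrow> e s i" using i(1) c_lim by (rule cont)
    have "\<forall>\<^sub>F n in sequentially. 0 < c n i"
      using c_lim[OF i(1)] i(2) by (rule order_tendstoD)
    then have "\<forall>\<^sub>F n in sequentially. e (c n) i \<le> x i"
      by eventually_elim (use c(1) i(1) in \<open>auto simp: P_def\<close>)
    then show "\<exists>N. \<forall>n\<ge>N. e (c n) i \<le> x i" by (simp add: eventually_sequentially)
  qed
  have s_max: "x i \<le> e s i" if i: "i \<in> S" "s i < L" for i
  proof (rule ccontr)
    assume "\<not> x i \<le> e s i"
    then have less: "e s i < x i" by simp
    \<comment> \<open>Perturbations of the supremum that should have been in \<open>P\<close>.\<close>
    define t where "t n = s(i := s i + inverse (real (Suc n)))" for n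
    have t_lim_i: "(\<lambda>n. t n i) \<longlonglongrightarrow> s i"
      using tendsto_add[OF tendsto_const LIMSEQ_inverse_real_of_nat, of "s i"] by (simp add: t_def)
    have "(\<lambda>n. t n j) \<longlonglongrightarrow> s j" for j
      using t_lim_i by (cases "j = i") (auto simp: t_def)
    then have "(\<lambda>n. e (t n) i) \<longlonglongrightarrow> e s i" using i(1) by (intro cont)
    then have "\<forall>\<^sub>F n in sequentially. e (t n) i < x i" using less by (rule order_tendstoD)
    moreover have "\<forall>\<^sub>F n in sequentially. t n i < L" using t_lim_i i(2) by (rule order_tendstoD)
    ultimately have "\<forall>\<^sub>F n in sequentially. e (t n) i < x i \<and> t n i < L" by eventually_elim simp
    then obtain n where n: "e (t n) i < x i" "t n i < L"
      by (auto dest: eventually_happens)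
    have "t n \<in> P"
      unfolding P_def
    proof (intro CollectI ballI)
      fix j assume j: "j \<in> S"
      show "0 \<le> t n j \<and> t n j \<le> L \<and> (0 < t n j \<longrightarrow> e (t n) j \<le> x j)"
      proof (cases "j = i")
        case True
        then show ?thesis using n s_nonneg[OF i(1)] by (auto simp: t_def)
      next
        case False
        then have "e (t n) j \<le> e s j" using j by (intro anti) (auto simp: t_def)
        then show ?thesis using False s_nonneg[OF j] s_le[OF j] s_sub[OF j] by (auto simp: t_def)
      qed
    qed
    from s_upper[OF this i(1)] show False by (simp add: t_def)
  qed
  show ?thesis by (rule that[of s]) (use s_nonneg s_le s_sub s_max in auto)
qed

text \<open>
  Otherwise each of the \<open>card S\<close> intervals \<open>((m - 1) R, m R]\<close> contains a value of \<open>a\<close>. Together with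
  the value \<open>0\<close> these are \<open>card S + 1\<close> distinct values of \<open>\<lceil>a k / R\<rceil>\<close>.
\<close>

lemma exists_gap:
  fixes a :: "'i \<Rightarrow> real" and R :: real
  assumes fin: "finite S" and R: "0 < R"
    and i: "i \<in> S" "a i = 0" and j: "j \<in> S" "a j = card S * R"
  obtains c where "0 \<le> c" "c < card S * R" "\<And>k. k \<in> S \<Longrightarrow> a k \<le> c \<or> c + R < a k"
proof (rule ccontr)
  assume no: "\<not> thesis"
  note gap = that
  have "\<exists>k\<in>S. \<lceil>a k / R\<rceil> = m" if m: "m \<in> {0..int (card S)}" for m
  proof (cases "m = 0")
    case True
    then show ?thesis using i by (intro bexI[of _ i]) auto
  next
    case False
    define c where "c = real_of_int (m - 1) * R"
    have "0 \<le> c" using m False R by (auto simp: c_def)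
    moreover have "c < card S * R" using m R by (auto simp: c_def)
    ultimately have "\<exists>k\<in>S. c < a k \<and> a k \<le> c + R"
      using gap[of c] no by (meson not_le)
    then obtain k where k: "k \<in> S" "c < a k" "a k \<le> c + R" by blast
    have "\<lceil>a k / R\<rceil> = m"
      using k R by (intro ceiling_unique) (auto simp: c_def field_simps)
    with k show ?thesis by auto
  qed
  then have "{0..int (card S)} \<subseteq> (\<lambda>k. \<lceil>a k / R\<rceil>) ` S" by blast
  then have "card {0..int (card S)} \<le> card S"
    using fin by (meson card_image_le card_mono finite_imageI order_trans)
  then show False by simp
qed

section \<open>Tails, call potentials and the convex order\<close>

lemma (in real_distribution) tail_integral_tendsto_0:
  assumes "integrable M (\<lambda>x. x)"
  shows "(\<lambda>n. \<integral>x. max (\<bar>x\<bar> - real n) 0 \<partial>M) \<longlonglongrightarrow> 0"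
proof -
  have "(\<lambda>n. \<integral>x. max (\<bar>x\<bar> - real n) 0 \<partial>M) \<longlonglongrightarrow> (\<integral>x. 0 \<partial>M)"
  proof (rule integral_dominated_convergence[where w="\<lambda>x. \<bar>x\<bar>"])
    show "integrable M (\<lambda>x. \<bar>x\<bar>)" using assms by simp
    show "AE x in M. (\<lambda>n. max (\<bar>x\<bar> - real n) 0) \<longlonglongrightarrow> 0"
    proof (rule AE_I2, rule tendsto_eventually)
      fix x :: real
      obtain N :: nat where "\<bar>x\<bar> \<le> real N" using real_arch_simple by blast
      then show "\<forall>\<^sub>F n in sequentially. max (\<bar>x\<bar> - real n) 0 = 0"
        by (auto simp: eventually_sequentially intro!: exI[of _ N])
    qed
  qed (auto simp: abs_if)
  then show ?thesis by simp
qed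

lemma (in real_distribution) integrable_call:
  assumes "integrable M (\<lambda>x. x)"
  shows "integrable M (\<lambda>z. max (z - x) 0)"
proof (rule Bochner_Integration.integrable_bound)
  show "integrable M (\<lambda>z. \<bar>z\<bar> + \<bar>x\<bar>)" using assms by simp
qed auto

text \<open>
  The call potential is 1-Lipschitz because each of the integrands is.
\<close>

lemma (in real_distribution) continuous_call_potential:
  assumes "integrable M (\<lambda>x. x)"
  shows "continuous_on A (call_potential M)"
proof -
  have "\<bar>call_potential M x - call_potential M y\<bar> \<le> \<bar>x - y\<bar>" for x y
  proof -
    have "\<bar>call_potential M x - call_potential M y\<bar> = \<bar>\<integral>z. max (z - x) 0 - max (z - y) 0 \<partial>M\<bar>"
      using integrable_call[OF assms] by (simp add: call_potential_def)
    also have "\<dots> \<le> (\<integral>z. \<bar>max (z - x) 0 - max (z - y) 0\<bar> \<partial>M)"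
      by (rule integral_abs_bound)
    also have "\<dots> \<le> (\<integral>z. \<bar>x - y\<bar> \<partial>M)"
      using integrable_call[OF assms] by (intro integral_mono) auto
    finally show ?thesis using prob_space by simp
  qed
  then show ?thesis
    by (auto simp: continuous_on_iff dist_real_def intro: le_less_trans)
qed

text \<open>
  For integrable functions the extended integral is the ordinary one, so the convex order can be tested
  on calls and on \<open>\<pm>x\<close> with Bochner integrals.
\<close>

lemma ext_integral_eq_integral:
  assumes "integrable M f"
  shows "ext_integral_defined M f" and "ext_integral M f = ereal (\<integral>x. f x \<partial>M)"
proof -
  have nn: "(\<integral>\<^sup>+x. ennreal (g x) \<partial>M) = ennreal (\<integral>x. max 0 (g x) \<partial>M)"
    if "integrable M g" for g :: "'a \<Rightarrow> real"
  proof -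
    have "(\<integral>\<^sup>+x. ennreal (g x) \<partial>M) = (\<integral>\<^sup>+x. ennreal (max 0 (g x)) \<partial>M)"
      by simp
    also have "\<dots> = ennreal (\<integral>x. max 0 (g x) \<partial>M)"
      using that by (intro nn_integral_eq_integral) auto
    finally show ?thesis .
  qed
  have f': "integrable M (\<lambda>x. - f x)" using assms by simp
  show "ext_integral_defined M f"
    by (simp add: ext_integral_defined_def nn[OF assms])
  have "ext_integral M f = ereal ((\<integral>x. max 0 (f x) \<partial>M) - (\<integral>x. max 0 (- f x) \<partial>M))"
    by (simp add: ext_integral_def nn[OF assms] nn[OF f'] enn2ereal_ennreal)
  also have "(\<integral>x. max 0 (f x) \<partial>M) - (\<integral>x. max 0 (- f x) \<partial>M) = (\<integral>x. max 0 (f x) - max 0 (- f x) \<partial>M)"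
    using assms by (intro Bochner_Integration.integral_diff[symmetric]) auto
  also have "\<dots> = (\<integral>x. f x \<partial>M)"
    by (intro Bochner_Integration.integral_cong) auto
  finally show "ext_integral M f = ereal (\<integral>x. f x \<partial>M)" .
qed

lemma convex_orderD:
  assumes "convex_order \<mu> \<nu>" "convex_on UNIV \<phi>" "integrable \<mu> \<phi>" "integrable \<nu> \<phi>"
  shows "(\<integral>x. \<phi> x \<partial>\<mu>) \<le> (\<integral>x. \<phi> x \<partial>\<nu>)"
  using assms ext_integral_eq_integral[OF assms(3)] ext_integral_eq_integral[OF assms(4)]
  by (auto simp: convex_order_def)

lemma convex_on_call: "convex_on UNIV (\<lambda>z::real. max (z - x) 0)"
proof (rule convex_onI)
  fix t y z :: real
  assume t: "0 < t" "t < 1"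
  have "(1 - t) * (y - x) + t * (z - x) \<le> (1 - t) * max (y - x) 0 + t * max (z - x) 0"
    using t by (intro add_mono mult_left_mono) auto
  moreover have "0 \<le> (1 - t) * max (y - x) 0 + t * max (z - x) 0"
    using t by simp
  moreover have "(1 - t) *\<^sub>R y + t *\<^sub>R z - x = (1 - t) * (y - x) + t * (z - x)"
    by (simp add: algebra_simps)
  ultimately show "max ((1 - t) *\<^sub>R y + t *\<^sub>R z - x) 0 \<le> (1 - t) * max (y - x) 0 + t * max (z - x) 0"
    by simp
qed simp

section \<open>Finitely many atoms at movable positions\<close>

text \<open>
  The atoms of \<open>\<mu>\<close> are indexed by their own locations \<open>s \<in> S\<close>, and a family of new positions is a
  function \<open>a\<close> of which only the values on \<open>S\<close> matter. Absolute continuity of \<open>q\<close> provides the absence of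
  atoms in \<open>q\<close>.
\<close>

locale finite_bass =
  mu: real_distribution \<mu> + nu: cdf_distribution \<nu> + qd: cdf_distribution q
  for \<mu> \<nu> q :: "real measure" +
  fixes S :: "real set"
  assumes finite_S: "finite S" and mu_S: "measure \<mu> S = 1"
    and atom_pos: "s \<in> S \<Longrightarrow> 0 < measure \<mu> {s}"
    and integrable_nu: "integrable \<nu> (\<lambda>x. x)"
    and q_atomless: "measure q {x} = 0"
begin

abbreviation p :: "real \<Rightarrow> real" where "p s \<equiv> measure \<mu> {s}"

lemma AE_mu_iff: "(AE x in \<mu>. P x) \<longleftrightarrow> (\<forall>s\<in>S. P s)"
proof
  assume "AE x in \<mu>. P x"
  then obtain N where N: "{x. \<not> P x} \<subseteq> N" "N \<in> sets borel" "emeasure \<mu> N = 0"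
    by (auto elim!: AE_E)
  show "\<forall>s\<in>S. P s"
  proof (rule ballI, rule ccontr)
    fix s assume s: "s \<in> S" "\<not> P s"
    then have "emeasure \<mu> {s} \<le> emeasure \<mu> N"
      using N by (intro emeasure_mono) auto
    with N(3) have "p s = 0" by (simp add: measure_def)
    with atom_pos[OF s(1)] show False by simp
  qed
next
  assume P: "\<forall>s\<in>S. P s"
  have "S \<in> sets \<mu>" using finite_S by (auto intro: borel_closed finite_imp_closed)
  then have "AE x in \<mu>. x \<in> S" using mu_S by (simp add: mu.AE_in_set_eq_1)
  then show "AE x in \<mu>. P x" by eventually_elim (use P in auto)
qed

lemma integral_mu:
  fixes g :: "real \<Rightarrow> real"
  assumes [measurable]: "g \<in> borel_measurable borel"
  shows "integrable \<mu> g" and "(\<integral>x. g x \<partial>\<mu>) = (\<Sum>s\<in>S. p s * g s)"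
proof -
  have eq: "AE x in \<mu>. g x = (\<Sum>s\<in>S. g s * indicator {s} x)"
    unfolding AE_mu_iff using finite_S by (simp add: indicator_def)
  have "has_bochner_integral \<mu> (\<lambda>x. \<Sum>s\<in>S. g s * indicator {s} x) (\<Sum>s\<in>S. g s * p s)"
    by (intro has_bochner_integral_sum has_bochner_integral_mult_right has_bochner_integral_real_indicator)
      (auto simp: mu.emeasure_eq_measure)
  then have "has_bochner_integral \<mu> g (\<Sum>s\<in>S. g s * p s)"
    using eq by (subst has_bochner_integral_cong_AE) auto
  then show "integrable \<mu> g" "(\<integral>x. g x \<partial>\<mu>) = (\<Sum>s\<in>S. p s * g s)"
    by (auto simp: has_bochner_integral_iff mult.commute)
qed

lemma sum_p: "(\<Sum>s\<in>S. p s) = 1"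
  using integral_mu(2)[of "\<lambda>_. 1"] mu.prob_space by simp

lemma nn_integral_mu:
  assumes [measurable]: "g \<in> borel_measurable borel"
  shows "(\<integral>\<^sup>+x. g x \<partial>\<mu>) = (\<Sum>s\<in>S. ennreal (p s) * g s)"
proof -
  have eq: "AE x in \<mu>. g x = (\<Sum>s\<in>S. g s * indicator {s} x)"
    unfolding AE_mu_iff using finite_S by (simp add: indicator_def if_distrib[of "\<lambda>x. _ * x"] cong: if_cong)
  have "(\<integral>\<^sup>+x. g x \<partial>\<mu>) = (\<integral>\<^sup>+x. (\<Sum>s\<in>S. g s * indicator {s} x) \<partial>\<mu>)"
    using eq by (rule nn_integral_cong_AE)
  also have "\<dots> = (\<Sum>s\<in>S. g s * emeasure \<mu> {s})"
    by (subst nn_integral_sum) (auto intro!: sum.cong nn_integral_cmult_indicator)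
  finally show ?thesis by (simp add: mu.emeasure_eq_measure mult.commute)
qed

text \<open>
  A Borel map that agrees with \<open>a\<close> on the atoms, so that \<open>\<alpha>\<close> is a push-forward of \<open>\<mu>\<close> and every
  computation can be carried out on the single product space \<open>\<mu> \<otimes> q\<close>.
\<close>

definition place :: "(real \<Rightarrow> real) \<Rightarrow> real \<Rightarrow> real" where
  "place a x = (\<Sum>s\<in>S. a s * indicator {s} x)"

lemma place_on [simp]: "s \<in> S \<Longrightarrow> place a s = a s"
  using finite_S by (simp add: place_def indicator_def if_distrib[of "\<lambda>x. _ * x"] cong: if_cong)

lemma measurable_place [measurable]: "place a \<in> borel_measurable borel"
  unfolding place_def by measurable

definition bass_law :: "(real \<Rightarrow> real) \<Rightarrow> real measure" where
  "bass_law a = distr \<mu> borel (place a)"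

sublocale bass_law: real_distribution "bass_law a"
  unfolding bass_law_def by (rule mu.real_distribution_distr) simp

lemma bass_law_pair:
  "bass_law a \<Otimes>\<^sub>M q = distr (\<mu> \<Otimes>\<^sub>M q) (borel \<Otimes>\<^sub>M q) (\<lambda>(x, y). (place a x, y))"
proof -
  have "bass_law a \<Otimes>\<^sub>M q = distr \<mu> borel (place a) \<Otimes>\<^sub>M distr q q (\<lambda>y. y)"
    by (simp add: bass_law_def)
  also have "\<dots> = distr (\<mu> \<Otimes>\<^sub>M q) (borel \<Otimes>\<^sub>M q) (\<lambda>(x, y). (place a x, y))"
    by (rule pair_measure_distr) (auto simp: qd.sigma_finite_measure_axioms)
  finally show ?thesis .
qed

lemma convolution_eq_distr:
  "bass_law a \<star> q = distr (\<mu> \<Otimes>\<^sub>M q) borel (\<lambda>(x, y). place a x + y)"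
  unfolding convolution_def bass_law_pair by (simp add: distr_distr o_def case_prod_beta')

sublocale pair: pair_prob_space \<mu> q ..

sublocale convolution: cdf_distribution "bass_law a \<star> q"
  unfolding cdf_distribution_def convolution_eq_distr
  by (rule pair.real_distribution_distr) measurable

lemma nn_integral_convolution_atoms:
  assumes [measurable]: "f \<in> borel_measurable borel"
  shows "(\<integral>\<^sup>+z. f z \<partial>(bass_law a \<star> q)) = (\<Sum>s\<in>S. ennreal (p s) * (\<integral>\<^sup>+y. f (a s + y) \<partial>q))"
proof -
  have "(\<integral>\<^sup>+z. f z \<partial>(bass_law a \<star> q)) = (\<integral>\<^sup>+w. f (place a (fst w) + snd w) \<partial>(\<mu> \<Otimes>\<^sub>M q))"
    unfolding convolution_eq_distr by (subst nn_integral_distr) (auto simp: case_prod_beta')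
  also have "\<dots> = (\<integral>\<^sup>+x. \<integral>\<^sup>+y. f (place a x + y) \<partial>q \<partial>\<mu>)"
    by (subst qd.nn_integral_fst[symmetric]) auto
  also have "\<dots> = (\<Sum>s\<in>S. ennreal (p s) * (\<integral>\<^sup>+y. f (place a s + y) \<partial>q))"
    by (rule nn_integral_mu) measurable
  finally show ?thesis by simp
qed

text \<open>
  Every component \<open>law(a s + Y)\<close> has positive weight \<open>p s\<close> in \<open>\<alpha> \<star> q\<close>, hence inherits its null sets.
\<close>

lemma AE_convolutionD:
  assumes "AE z in bass_law a \<star> q. P z" and s: "s \<in> S"
  shows "AE y in q. P (a s + y)"
proof -
  obtain N where N: "{z. \<not> P z} \<subseteq> N" "N \<in> sets borel" "emeasure (bass_law a \<star> q) N = 0"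
    using assms(1) by (auto elim!: AE_E)
  note [measurable] = N(2)
  have "(\<Sum>s\<in>S. ennreal (p s) * (\<integral>\<^sup>+y. indicator N (a s + y) \<partial>q)) = 0"
    using nn_integral_convolution_atoms[of "indicator N" a] N(2,3) by simp
  then have "(\<integral>\<^sup>+y. indicator N (a s + y) \<partial>q) = 0"
    using s atom_pos[OF s] finite_S by auto
  then have "AE y in q. indicator N (a s + y) = (0::ennreal)"
    by (subst (asm) nn_integral_0_iff_AE) auto
  then show ?thesis
    by eventually_elim (use N(1) in \<open>auto simp: indicator_def split: if_splits\<close>)
qed

lemma integral_convolution_atoms:
  fixes f :: "real \<Rightarrow> real"
  assumes f: "integrable (bass_law a \<star> q) f"
  shows "s \<in> S \<Longrightarrow> integrable q (\<lambda>y. f (a s + y))"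
    and "(\<integral>z. f z \<partial>(bass_law a \<star> q)) = (\<Sum>s\<in>S. p s * (\<integral>y. f (a s + y) \<partial>q))"
proof -
  have [measurable]: "f \<in> borel_measurable borel"
    using f by (auto dest: borel_measurable_integrable)
  have int: "integrable (\<mu> \<Otimes>\<^sub>M q) (\<lambda>(x, y). f (place a x + y))"
    using f unfolding convolution_eq_distr
    by (subst (asm) integrable_distr_eq) (auto simp: case_prod_beta')
  have "AE x in \<mu>. integrable q (\<lambda>y. f (place a x + y))"
    using pair.AE_integrable_fst'[OF int] by simp
  then show "s \<in> S \<Longrightarrow> integrable q (\<lambda>y. f (a s + y))"
    unfolding AE_mu_iff by auto
  have "(\<integral>z. f z \<partial>(bass_law a \<star> q)) = (\<integral>w. (case w of (x, y) \<Rightarrow> f (place a x + y)) \<partial>(\<mu> \<Otimes>\<^sub>M q))"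
    unfolding convolution_eq_distr by (subst integral_distr) (auto simp: case_prod_beta')
  also have "\<dots> = (\<integral>x. \<integral>y. f (place a x + y) \<partial>q \<partial>\<mu>)"
    using pair.integral_fst'[OF int] by simp
  also have "\<dots> = (\<Sum>s\<in>S. p s * (\<integral>y. f (place a s + y) \<partial>q))"
    by (rule integral_mu(2)) measurable
  finally show "(\<integral>z. f z \<partial>(bass_law a \<star> q)) = (\<Sum>s\<in>S. p s * (\<integral>y. f (a s + y) \<partial>q))"
    by simp
qed

lemma cdf_convolution: "cdf (bass_law a \<star> q) z = (\<Sum>s\<in>S. p s * cdf q (z - a s))"
proof -
  have "cdf (bass_law a \<star> q) z = (\<integral>w. indicator {..z} w \<partial>(bass_law a \<star> q))"
    by (simp add: cdf_def)
  also have "\<dots> = (\<Sum>s\<in>S. p s * (\<integral>y. indicator {..z} (a s + y) \<partial>q))"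
    by (rule integral_convolution_atoms(2)) (auto simp: convolution.emeasure_eq_measure)
  also have "\<dots> = (\<Sum>s\<in>S. p s * cdf q (z - a s))"
  proof (rule sum.cong)
    fix s
    have "(\<integral>y. indicator {..z} (a s + y) \<partial>q) = (\<integral>y. indicator {..z - a s} y \<partial>q)"
      by (intro Bochner_Integration.integral_cong) (auto simp: indicator_def)
    also have "\<dots> = cdf q (z - a s)"
      by (simp add: cdf_def)
    finally show "p s * (\<integral>y. indicator {..z} (a s + y) \<partial>q) = p s * cdf q (z - a s)"
      by simp
  qed simp
  finally show ?thesis .
qed

lemma isCont_cdf_q: "isCont (cdf q) z"
  by (simp add: qd.isCont_cdf q_atomless)

lemma isCont_cdf_convolution: "isCont (cdf (bass_law a \<star> q)) z"
proof -
  have "isCont (\<lambda>z. \<Sum>s\<in>S. p s * cdf q (z - a s)) z"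
    by (intro continuous_intros isCont_o2[OF _ isCont_cdf_q])
  then show ?thesis by (simp add: cdf_convolution[abs_def])
qed

text \<open>
  The map \<open>T\<close> of the Bass martingale, as a real-valued function.
\<close>

definition terminal :: "(real \<Rightarrow> real) \<Rightarrow> real \<Rightarrow> real" where
  "terminal a z = quant \<nu> (cdf (bass_law a \<star> q) z)"

lemma measurable_terminal [measurable]: "terminal a \<in> borel_measurable borel"
  unfolding terminal_def[abs_def] by measurable

lemma distr_terminal: "distr (bass_law a \<star> q) borel (terminal a) = \<nu>"
  unfolding terminal_def[abs_def]
  by (rule distr_quant_cdf) (auto simp: isCont_cdf_convolution nu.real_distribution_axioms convolution.real_distribution_axioms)

text \<open>
  Under each component the level \<open>F (a s + Y)\<close> is absolutely continuous, because its law, weighted by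
  \<open>p s\<close>, is dominated by the uniform law.
\<close>

lemma AE_level:
  assumes "AE u in lborel. 0 < u \<longrightarrow> u < 1 \<longrightarrow> P u" and "s \<in> S"
  shows "AE y in q. 0 < cdf (bass_law a \<star> q) (a s + y) \<and> cdf (bass_law a \<star> q) (a s + y) < 1
    \<and> P (cdf (bass_law a \<star> q) (a s + y))"
  by (rule AE_convolutionD[OF AE_cdf_of_continuous assms(2)])
    (use assms(1) isCont_cdf_convolution convolution.real_distribution_axioms in auto)

lemma AE_level_01:
  "s \<in> S \<Longrightarrow> AE y in q. 0 < cdf (bass_law a \<star> q) (a s + y) \<and> cdf (bass_law a \<star> q) (a s + y) < 1"
  using AE_level[of "\<lambda>_. True" s a] by simp

text \<open>
  The average of the laws of \<open>T (a s + Y)\<close> over the atoms is \<open>\<nu>\<close>. This is how integrability of \<open>\<nu>\<close>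
  controls \<open>T\<close> uniformly in the positions \<open>a\<close>.
\<close>

lemma integral_terminal:
  fixes \<phi> :: "real \<Rightarrow> real"
  assumes "integrable \<nu> \<phi>"
  shows "s \<in> S \<Longrightarrow> integrable q (\<lambda>y. \<phi> (terminal a (a s + y)))"
    and "(\<Sum>s\<in>S. p s * (\<integral>y. \<phi> (terminal a (a s + y)) \<partial>q)) = (\<integral>z. \<phi> z \<partial>\<nu>)"
proof -
  have [measurable]: "\<phi> \<in> borel_measurable borel"
    using assms by (auto dest: borel_measurable_integrable)
  have int: "integrable (bass_law a \<star> q) (\<lambda>z. \<phi> (terminal a z))"
    using assms by (subst (asm) distr_terminal[of a, symmetric]) (simp add: integrable_distr_eq)
  show "s \<in> S \<Longrightarrow> integrable q (\<lambda>y. \<phi> (terminal a (a s + y)))"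
    by (rule integral_convolution_atoms(1)[OF int])
  have "(\<integral>z. \<phi> z \<partial>\<nu>) = (\<integral>z. \<phi> (terminal a z) \<partial>(bass_law a \<star> q))"
    by (subst distr_terminal[of a, symmetric]) (simp add: integral_distr)
  also have "\<dots> = (\<Sum>s\<in>S. p s * (\<integral>y. \<phi> (terminal a (a s + y)) \<partial>q))"
    by (rule integral_convolution_atoms(2)[OF int])
  finally show "(\<Sum>s\<in>S. p s * (\<integral>y. \<phi> (terminal a (a s + y)) \<partial>q)) = (\<integral>z. \<phi> z \<partial>\<nu>)" ..
qed

definition avg :: "(real \<Rightarrow> real) \<Rightarrow> real \<Rightarrow> real" where
  "avg a s = (\<integral>y. terminal a (a s + y) \<partial>q)"

lemma integrable_terminal: "s \<in> S \<Longrightarrow> integrable q (\<lambda>y. terminal a (a s + y))"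
  by (rule integral_terminal(1)[OF integrable_nu])

lemma sum_avg: "(\<Sum>s\<in>S. p s * avg a s) = (\<integral>z. z \<partial>\<nu>)"
  unfolding avg_def by (rule integral_terminal(2)[OF integrable_nu])

text \<open>
  The level at \<open>a s + y\<close> depends on \<open>a\<close> only through the differences \<open>a s - a t\<close>, monotonically in each
  of them. Almost everywhere is the best one can say, since the real-valued quantile need not be
  monotone at the levels \<open>0\<close> and \<open>1\<close>.
\<close>

lemma terminal_mono:
  assumes s: "s \<in> S" and le: "\<And>t. t \<in> S \<Longrightarrow> a s - a t \<le> b s - b t"
  shows "AE y in q. terminal a (a s + y) \<le> terminal b (b s + y)"
  using AE_level_01[OF s, of a] AE_level_01[OF s, of b]
proof eventually_elim
  case (elim y)
  have "cdf (bass_law a \<star> q) (a s + y) \<le> cdf (bass_law b \<star> q) (b s + y)"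
    unfolding cdf_convolution
  proof (intro sum_mono mult_left_mono qd.cdf_nondecreasing)
    fix t assume "t \<in> S"
    from le[OF this] show "a s + y - a t \<le> b s + y - b t" by simp
  qed simp
  then show ?case unfolding terminal_def using elim by (intro nu.quant_mono) auto
qed

lemma avg_antimono:
  assumes "s \<in> S" "a s = b s" "\<And>t. t \<in> S \<Longrightarrow> a t \<le> b t"
  shows "avg b s \<le> avg a s"
  unfolding avg_def using assms
  by (intro integral_mono_AE integrable_terminal terminal_mono) auto

lemma AE_isCont_quant: "AE u in lborel. 0 < u \<longrightarrow> u < 1 \<longrightarrow> isCont (quant \<nu>) u"
proof -
  have "mono_on {0<..<1} (quant \<nu>)"
    by (auto simp: mono_on_def intro: nu.quant_mono)
  then have "countable {u\<in>{0<..<1}. \<not> continuous (at u within {0<..<1}) (quant \<nu>)}"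
    by (rule mono_on_ctble_discont)
  then have "AE u in lborel. u \<notin> {u\<in>{0<..<1}. \<not> continuous (at u within {0<..<1}) (quant \<nu>)}"
    by (intro AE_not_in countable_imp_null_set_lborel)
  then show ?thesis
    by eventually_elim (auto simp: at_within_open[of _ "{0 <..< 1}"])
qed

text \<open>
  Dominated convergence. Pointwise convergence can fail only at the countably many jumps of the
  quantile function, which the random level avoids. A dominating function comes from
  monotonicity: positions within distance \<open>1\<close> of \<open>b\<close> have all differences \<open>a s - a t\<close> between those of two
  fixed families of positions, and these have integrable terminal values.
\<close>

lemma avg_tendsto:
  fixes a :: "nat \<Rightarrow> real \<Rightarrow> real"
  assumes s: "s \<in> S" and lim: "\<And>t. t \<in> S \<Longrightarrow> (\<lambda>n. a n t) \<longlonglongrightarrow> b t"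
  shows "(\<lambda>n. avg (a n) s) \<longlonglongrightarrow> avg b s"
proof -
  have "\<forall>\<^sub>F n in sequentially. dist (a n t) (b t) < 1" if "t \<in> S" for t
    using lim[OF that] by (rule tendstoD) simp
  then have "\<forall>\<^sub>F n in sequentially. \<forall>t\<in>S. dist (a n t) (b t) < 1"
    using finite_S by (simp add: eventually_ball_finite)
  then obtain N where "\<forall>n\<ge>N. \<forall>t\<in>S. dist (a n t) (b t) < 1"
    unfolding eventually_sequentially by blast
  then have N: "\<bar>a n t - b t\<bar> < 1" if "n \<ge> N" "t \<in> S" for n t
    using that by (simp add: dist_real_def)
  \<comment> \<open>Extreme positions: all differences to \<open>s\<close> are made as small, or as large, as possible.\<close>
  define lo where "lo t = (if t = s then b s - 1 else b t + 1)" for t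
  define hi where "hi t = (if t = s then b s + 1 else b t - 1)" for t
  have "(\<lambda>n. avg (a (n + N)) s) \<longlonglongrightarrow> avg b s"
    unfolding avg_def
  proof (rule integral_dominated_convergence[where
        w="\<lambda>y. \<bar>terminal lo (lo s + y)\<bar> + \<bar>terminal hi (hi s + y)\<bar>"])
    show "integrable q (\<lambda>y. \<bar>terminal lo (lo s + y)\<bar> + \<bar>terminal hi (hi s + y)\<bar>)"
      using integrable_terminal[OF s] by auto
    show "AE y in q. norm (terminal (a (n + N)) (a (n + N) s + y))
        \<le> \<bar>terminal lo (lo s + y)\<bar> + \<bar>terminal hi (hi s + y)\<bar>" for n
    proof -
      have "AE y in q. terminal lo (lo s + y) \<le> terminal (a (n + N)) (a (n + N) s + y)"
      proof (rule terminal_mono[OF s])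
        fix t assume t: "t \<in> S"
        show "lo s - lo t \<le> a (n + N) s - a (n + N) t"
          using N[of "n + N" s] N[of "n + N" t] t s by (auto simp: lo_def)
      qed
      moreover have "AE y in q. terminal (a (n + N)) (a (n + N) s + y) \<le> terminal hi (hi s + y)"
      proof (rule terminal_mono[OF s])
        fix t assume t: "t \<in> S"
        show "a (n + N) s - a (n + N) t \<le> hi s - hi t"
          using N[of "n + N" s] N[of "n + N" t] t s by (auto simp: hi_def)
      qed
      ultimately show ?thesis by eventually_elim auto
    qed
    show "AE y in q. (\<lambda>n. terminal (a (n + N)) (a (n + N) s + y)) \<longlonglongrightarrow> terminal b (b s + y)"
      using AE_level[OF AE_isCont_quant s, of b]
    proof eventually_elim
      case (elim y)
      have "(\<lambda>n. cdf (bass_law (a (n + N)) \<star> q) (a (n + N) s + y))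
          \<longlonglongrightarrow> cdf (bass_law b \<star> q) (b s + y)"
        unfolding cdf_convolution
        by (intro tendsto_intros isCont_tendsto_compose[OF isCont_cdf_q] LIMSEQ_ignore_initial_segment lim s)
      then show ?case
        unfolding terminal_def using elim by (intro isCont_tendsto_compose[where g="quant \<nu>"]) simp_all
    qed
  qed measurable
  then show ?thesis by (rule LIMSEQ_offset)
qed

end

section \<open>Consequences of irreducibility\<close>

context finite_bass
begin

text \<open>
  The left side is at most \<open>\<Sum>s\<in>S. p s * max (s - x) 0 = C\<^sub>\<mu>(x) \<le> C\<^sub>\<nu>(x)\<close>, and somewhere in this chain the
  inequality is strict: for \<open>x\<close> in the interval of irreducibility it is the last one. Otherwise \<open>x\<close>
  lies to the left or to the right of all atoms, since these belong to the interval. On the left, an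
  atom outside \<open>B\<close> is missing in the sum; on the right, the sum is negative. Optimising over \<open>x\<close>
  shows that the top slice of \<open>\<nu>\<close> of mass \<open>p(B)\<close> has first moment above that of any such \<open>B\<close>.
\<close>

lemma irreducible_strict:
  assumes irr: "irreducible_pair \<mu> \<nu>" and B: "B \<subseteq> S" "B \<noteq> {}" "B \<noteq> S"
  shows "(\<Sum>s\<in>B. p s * (s - x)) < call_potential \<nu> x"
proof -
  define I where "I = {x. call_potential \<mu> x < call_potential \<nu> x}"
  have co: "convex_order \<mu> \<nu>" and int_I: "is_interval I" and mu_I: "measure \<mu> I = 1"
    using irr by (auto simp: irreducible_pair_def I_def)
  have "I \<in> sets \<mu>" using mu_I measure_notin_sets[of I \<mu>] by (cases "I \<in> sets \<mu>") auto
  then have "AE x in \<mu>. x \<in> I" using mu_I by (simp add: mu.AE_in_set_eq_1)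
  then have S_I: "s \<in> I" if "s \<in> S" for s using that unfolding AE_mu_iff by auto
  have le: "call_potential \<mu> x \<le> call_potential \<nu> x"
    unfolding call_potential_def
    by (intro convex_orderD[OF co convex_on_call] integral_mu(1) nu.integrable_call[OF integrable_nu]) auto
  have fin: "finite B" using B(1) finite_S by (rule finite_subset)
  have C_mu: "call_potential \<mu> x = (\<Sum>s\<in>S. p s * max (s - x) 0)"
    unfolding call_potential_def by (rule integral_mu(2)) auto
  have le1: "(\<Sum>s\<in>B. p s * (s - x)) \<le> (\<Sum>s\<in>B. p s * max (s - x) 0)"
    by (intro sum_mono mult_left_mono) auto
  have le2: "(\<Sum>s\<in>B. p s * max (s - x) 0) \<le> call_potential \<mu> x"
    unfolding C_mu using B(1) finite_S by (intro sum_mono2) auto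
  show ?thesis
  proof (cases "x \<in> I")
    case True
    then show ?thesis using le1 le2 by (auto simp: I_def)
  next
    case False
    then have "(\<forall>s\<in>S. x < s) \<or> (\<forall>s\<in>S. s < x)"
      using int_I S_I unfolding is_interval_1 by (meson not_le)
    then show ?thesis
    proof
      assume above: "\<forall>s\<in>S. x < s"
      obtain t where t: "t \<in> S" "t \<notin> B" using B by auto
      have "(\<Sum>s\<in>B. p s * max (s - x) 0) < (\<Sum>s\<in>S. p s * max (s - x) 0)"
        using B(1) finite_S t above atom_pos[OF t(1)]
        by (intro sum_strict_mono2[of S B t]) auto
      then show ?thesis using le1 le C_mu by simp
    next
      assume below: "\<forall>s\<in>S. s < x"
      have "(\<Sum>s\<in>B. p s * (s - x)) < (\<Sum>s\<in>B. 0)"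
        using below B(1,2) fin atom_pos by (intro sum_strict_mono) (auto intro!: mult_pos_neg)
      moreover have "0 \<le> call_potential \<nu> x" by (simp add: call_potential_def)
      ultimately show ?thesis by simp
    qed
  qed
qed

lemma irreducible_mean:
  assumes irr: "irreducible_pair \<mu> \<nu>"
  shows "(\<Sum>s\<in>S. p s * s) = (\<integral>z. z \<partial>\<nu>)"
proof -
  have co: "convex_order \<mu> \<nu>" using irr by (simp add: irreducible_pair_def)
  have int: "integrable \<mu> (\<lambda>x. x)" by (rule integral_mu(1)) simp
  have "(\<integral>x. x \<partial>\<mu>) \<le> (\<integral>x. x \<partial>\<nu>)"
    by (intro convex_orderD[OF co] int integrable_nu convex_onI) auto
  moreover have "(\<integral>x. - x \<partial>\<mu>) \<le> (\<integral>x. - x \<partial>\<nu>)"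
    using int integrable_nu by (intro convex_orderD[OF co] convex_onI) (auto simp: algebra_simps)
  ultimately have "(\<integral>x. x \<partial>\<mu>) = (\<integral>x. x \<partial>\<nu>)" by simp
  then show ?thesis using integral_mu(2)[of "\<lambda>x. x"] by simp
qed

end

section \<open>Widely separated positions and the choice of positions\<close>

context finite_bass
begin

text \<open>
  Let \<open>N = T (X + Y)\<close> and let \<open>x'\<close> be the value of \<open>T\<close> at the middle of the gap. Unless \<open>\<bar>Y\<bar>\<close> reaches half of
  the gap, \<open>N \<ge> x'\<close> holds when \<open>X\<close> sits in the upper part and \<open>N \<le> x'\<close> when it sits in the lower one, so that
  \<open>max (N - x') 0\<close>, whose mean is the call potential at \<open>x'\<close>, equals \<open>N - x'\<close> on the upper part and
  vanishes on the lower part. On the exceptional event the error is at most \<open>\<bar>N\<bar> + H\<close>. Truncating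
  \<open>\<bar>N\<bar>\<close> at \<open>K\<close>, the bounded part costs a multiple of the probability of the event and the rest a tail
  of \<open>\<nu>\<close>; both are independent of the positions.
\<close>

lemma avg_of_separated:
  fixes x' R :: real
  assumes c: "\<And>s. s \<in> B \<Longrightarrow> c + R < a s" "\<And>s. s \<in> S - B \<Longrightarrow> a s \<le> c" and B: "B \<subseteq> S"
    and x': "x' = terminal a (c + R / 2)"
    and level: "0 < cdf (bass_law a \<star> q) (c + R / 2)" "cdf (bass_law a \<star> q) (c + R / 2) < 1"
    and H: "\<bar>x'\<bar> \<le> H" and K: "0 \<le> K"
  shows "call_potential \<nu> x' \<le> (\<Sum>s\<in>B. p s * (avg a s - x'))
    + (K + H) * (cdf q (- (R / 2)) + 1 - cdf q (R / 2)) + (\<integral>z. max (\<bar>z\<bar> - K) 0 \<partial>\<nu>)"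
proof -
  let ?N = "\<lambda>s y. terminal a (a s + y)"
  define E where "E = {.. - (R / 2)} \<union> {R / 2<..}"
  have [measurable]: "E \<in> sets borel" by (auto simp: E_def)
  have qE: "measure q E \<le> cdf q (- (R / 2)) + 1 - cdf q (R / 2)"
  proof -
    have "measure q E \<le> measure q {.. - (R / 2)} + measure q {R / 2<..}"
      unfolding E_def by (rule measure_Un_le) auto
    also have "measure q {R / 2<..} = 1 - measure q {..R / 2}"
      by (subst qd.prob_compl[symmetric]) (auto intro!: arg_cong[where f="measure q"])
    finally show ?thesis by (simp add: cdf_def)
  qed
  have tail_int: "integrable \<nu> (\<lambda>z. max (\<bar>z\<bar> - K) 0)"
  proof (rule Bochner_Integration.integrable_bound)
    show "integrable \<nu> (\<lambda>z. \<bar>z\<bar>)" using integrable_nu by simp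
  qed (use K in auto)
  note call_int = nu.integrable_call[OF integrable_nu, of x']
  have pointwise: "AE y in q. max (?N s y - x') 0 \<le>
      (if s \<in> B then ?N s y - x' else 0) + (K + H) * indicator E y + max (\<bar>?N s y\<bar> - K) 0"
    if s: "s \<in> S" for s
    using AE_level_01[OF s, of a]
  proof eventually_elim
    case (elim y)
    show ?case
    proof (cases "y \<in> E")
      case True
      have "\<bar>?N s y\<bar> \<le> K + max (\<bar>?N s y\<bar> - K) 0" by simp
      then show ?thesis using True H K by auto
    next
      case False
      then have y: "- (R / 2) < y" "y \<le> R / 2" by (auto simp: E_def)
      show ?thesis
      proof (cases "s \<in> B")
        case True
        then have "c + R / 2 \<le> a s + y" using c(1)[of s] y by (simp add: field_simps)
        then have "x' \<le> ?N s y"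
          unfolding x' terminal_def using elim level
          by (intro nu.quant_mono convolution.cdf_nondecreasing) auto
        then show ?thesis using True False K H by auto
      next
        case sB: False
        then have "a s + y \<le> c + R / 2" using c(2)[of s] s y by (simp add: field_simps)
        then have "?N s y \<le> x'"
          unfolding x' terminal_def using elim level
          by (intro nu.quant_mono convolution.cdf_nondecreasing) auto
        then show ?thesis using sB False K H by auto
      qed
    qed
  qed
  have each: "(\<integral>y. max (?N s y - x') 0 \<partial>q) \<le>
      (if s \<in> B then avg a s - x' else 0) + (K + H) * measure q E + (\<integral>y. max (\<bar>?N s y\<bar> - K) 0 \<partial>q)"
    if s: "s \<in> S" for s
  proof -
    note i = integrable_terminal[OF s, of a] integral_terminal(1)[OF tail_int s, of a]
    have "(\<integral>y. max (?N s y - x') 0 \<partial>q) \<le> (\<integral>y. (if s \<in> B then ?N s y - x' else 0)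
        + (K + H) * indicator E y + max (\<bar>?N s y\<bar> - K) 0 \<partial>q)"
    proof (rule integral_mono_AE[OF _ _ pointwise[OF s]])
      have "integrable q (\<lambda>y. if s \<in> B then ?N s y - x' else 0)"
        using i(1) by (cases "s \<in> B") simp_all
      moreover have "integrable q (\<lambda>y. (K + H) * indicator E y)"
        by (simp add: qd.emeasure_eq_measure)
      ultimately show "integrable q (\<lambda>y. (if s \<in> B then ?N s y - x' else 0)
          + (K + H) * indicator E y + max (\<bar>?N s y\<bar> - K) 0)"
        using i(2) by (intro Bochner_Integration.integrable_add)
    qed (rule integral_terminal(1)[OF call_int s])
    also have "\<dots> = (if s \<in> B then avg a s - x' else 0) + (K + H) * measure q E
        + (\<integral>y. max (\<bar>?N s y\<bar> - K) 0 \<partial>q)"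
      using i qd.prob_space by (cases "s \<in> B") (simp_all add: avg_def qd.emeasure_eq_measure)
    finally show ?thesis .
  qed
  have "call_potential \<nu> x' = (\<Sum>s\<in>S. p s * (\<integral>y. max (?N s y - x') 0 \<partial>q))"
    using integral_terminal(2)[OF call_int, of a] by (simp add: call_potential_def)
  also have "\<dots> \<le> (\<Sum>s\<in>S. p s * ((if s \<in> B then avg a s - x' else 0) + (K + H) * measure q E
        + (\<integral>y. max (\<bar>?N s y\<bar> - K) 0 \<partial>q)))"
    using each by (intro sum_mono mult_left_mono) auto
  also have "\<dots> = (\<Sum>s\<in>S. if s \<in> B then p s * (avg a s - x') else 0) + (\<Sum>s\<in>S. p s) * ((K + H) * measure q E)
      + (\<Sum>s\<in>S. p s * (\<integral>y. max (\<bar>?N s y\<bar> - K) 0 \<partial>q))"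
    by (simp add: distrib_left sum.distrib sum_distrib_right if_distrib[of "\<lambda>x. _ * x"] cong: if_cong)
  also have "(\<Sum>s\<in>S. p s * (\<integral>y. max (\<bar>?N s y\<bar> - K) 0 \<partial>q)) = (\<integral>z. max (\<bar>z\<bar> - K) 0 \<partial>\<nu>)"
    by (rule integral_terminal(2)[OF tail_int])
  also have "(\<Sum>s\<in>S. if s \<in> B then p s * (avg a s - x') else 0) = (\<Sum>s\<in>B. p s * (avg a s - x'))"
    using B finite_S by (simp add: sum.inter_restrict[symmetric] Int_absorb1)
  also have "(K + H) * measure q E \<le> (K + H) * (cdf q (- (R / 2)) + 1 - cdf q (R / 2))"
    using qE K H by (intro mult_left_mono) auto
  finally show ?thesis by (simp add: sum_p)
qed

text \<open>
  At the middle of the gap each lower atom contributes at least, and each upper atom at most, half of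
  its mass, and both groups have mass at least \<open>m\<close>. This keeps the level away from \<open>0\<close> and \<open>1\<close>,
  and hence the corresponding quantile in a compact interval that does not depend on the positions.
\<close>

lemma separated_level_bounds:
  assumes c: "\<And>s. s \<in> B \<Longrightarrow> c + R < a s" "\<And>s. s \<in> S - B \<Longrightarrow> a s \<le> c"
    and B: "B \<subseteq> S" "B \<noteq> {}" "B \<noteq> S"
    and G: "1 / 2 \<le> cdf q (R / 2)" "cdf q (- (R / 2)) \<le> 1 / 2"
    and m: "\<And>s. s \<in> S \<Longrightarrow> m \<le> p s"
  shows "m / 2 \<le> cdf (bass_law a \<star> q) (c + R / 2)" "cdf (bass_law a \<star> q) (c + R / 2) \<le> 1 - m / 2"
proof -
  have split: "(\<Sum>s\<in>S. f s) = (\<Sum>s\<in>B. f s) + (\<Sum>s\<in>S - B. f s)" for f :: "real \<Rightarrow> real"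
    using sum.subset_diff[OF B(1) finite_S, of f] by simp
  have m_le: "m \<le> (\<Sum>s\<in>A. p s)" if A: "A \<subseteq> S" "A \<noteq> {}" for A
  proof -
    obtain s where "s \<in> A" using A(2) by auto
    then show ?thesis
      using A m[of s] member_le_sum[of s A p] finite_subset[OF A(1) finite_S] by auto
  qed
  have up: "p s * cdf q (c + R / 2 - a s) \<le> p s * (1 / 2)" if "s \<in> B" for s
  proof (intro mult_left_mono)
    have "cdf q (c + R / 2 - a s) \<le> cdf q (- (R / 2))"
      using c(1)[OF that] by (intro qd.cdf_nondecreasing) (simp add: field_simps)
    with G(2) show "cdf q (c + R / 2 - a s) \<le> 1 / 2" by simp
  qed simp
  have low: "p s * (1 / 2) \<le> p s * cdf q (c + R / 2 - a s)" if "s \<in> S - B" for s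
  proof (intro mult_left_mono)
    have "cdf q (R / 2) \<le> cdf q (c + R / 2 - a s)"
      using c(2)[OF that] by (intro qd.cdf_nondecreasing) simp
    with G(1) show "1 / 2 \<le> cdf q (c + R / 2 - a s)" by simp
  qed simp
  have "m / 2 \<le> (\<Sum>s\<in>S - B. p s * (1 / 2))"
    using m_le[of "S - B"] B by (auto simp: sum_divide_distrib[symmetric])
  also have "\<dots> \<le> (\<Sum>s\<in>S - B. p s * cdf q (c + R / 2 - a s))"
    using low by (intro sum_mono) auto
  also have "\<dots> \<le> cdf (bass_law a \<star> q) (c + R / 2)"
    unfolding cdf_convolution split[of "\<lambda>s. p s * cdf q (c + R / 2 - a s)"]
    using qd.cdf_nonneg by (simp add: sum_nonneg)
  finally show "m / 2 \<le> cdf (bass_law a \<star> q) (c + R / 2)" .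
  have "cdf (bass_law a \<star> q) (c + R / 2) \<le> (\<Sum>s\<in>B. p s * (1 / 2)) + (\<Sum>s\<in>S - B. p s)"
    unfolding cdf_convolution split[of "\<lambda>s. p s * cdf q (c + R / 2 - a s)"]
    using up qd.cdf_bounded_prob by (intro add_mono sum_mono) (auto intro!: mult_left_le)
  also have "\<dots> = 1 - (\<Sum>s\<in>B. p s) / 2"
    using split[of p] sum_p by (simp add: sum_divide_distrib[symmetric])
  also have "\<dots> \<le> 1 - m / 2" using m_le[OF B(1,2)] by simp
  finally show "cdf (bass_law a \<star> q) (c + R / 2) \<le> 1 - m / 2" .
qed

text \<open>
  Compactness of \<open>[lo, hi]\<close>, continuity of the call potential and finiteness of the family of subsets
  turn the pointwise strict inequality into a uniform one.
\<close>

lemma uniform_slack: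
  assumes strict: "\<And>B x. B \<subseteq> S \<Longrightarrow> B \<noteq> {} \<Longrightarrow> B \<noteq> S \<Longrightarrow>
      (\<Sum>s\<in>B. p s * (s - x)) < call_potential \<nu> x"
    and "lo \<le> hi"
  obtains \<delta> where "0 < \<delta>" "\<And>B x. B \<subseteq> S \<Longrightarrow> B \<noteq> {} \<Longrightarrow> B \<noteq> S \<Longrightarrow> lo \<le> x \<Longrightarrow> x \<le> hi \<Longrightarrow>
      (\<Sum>s\<in>B. p s * (s - x)) + \<delta> \<le> call_potential \<nu> x"
proof -
  define \<B> where "\<B> = Pow S - {{}, S}"
  have "\<exists>\<delta>>0. \<forall>x\<in>{lo..hi}. (\<Sum>s\<in>B. p s * (s - x)) + \<delta> \<le> call_potential \<nu> x"
    if B: "B \<in> \<B>" for B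
  proof -
    let ?g = "\<lambda>x. call_potential \<nu> x - (\<Sum>s\<in>B. p s * (s - x))"
    have "continuous_on {lo..hi} ?g"
      by (intro continuous_intros nu.continuous_call_potential integrable_nu)
    then obtain x where x: "x \<in> {lo..hi}" "\<And>y. y \<in> {lo..hi} \<Longrightarrow> ?g x \<le> ?g y"
      using continuous_attains_inf[of "{lo..hi}" ?g] \<open>lo \<le> hi\<close> by auto
    show ?thesis
      using strict[of B x] B x(2) by (intro exI[of _ "?g x"]) (auto simp: \<B>_def algebra_simps)
  qed
  then have "\<forall>B\<in>\<B>. \<exists>\<delta>. 0 < \<delta> \<and> (\<forall>x\<in>{lo..hi}. (\<Sum>s\<in>B. p s * (s - x)) + \<delta> \<le> call_potential \<nu> x)"
    by blast
  from bchoice[OF this] obtain d where d: "\<And>B. B \<in> \<B> \<Longrightarrow> 0 < d B"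
    "\<And>B x. B \<in> \<B> \<Longrightarrow> x \<in> {lo..hi} \<Longrightarrow> (\<Sum>s\<in>B. p s * (s - x)) + d B \<le> call_potential \<nu> x"
    by blast
  have fin: "finite (insert 1 (d ` \<B>))" using finite_S by (simp add: \<B>_def)
  show ?thesis
  proof (rule that[of "Min (insert 1 (d ` \<B>))"])
    show "0 < Min (insert 1 (d ` \<B>))" using fin d(1) by (subst Min_gr_iff) auto
    fix B x assume "B \<subseteq> S" "B \<noteq> {}" "B \<noteq> S" "lo \<le> x" "x \<le> hi"
    then have "B \<in> \<B>" "x \<in> {lo..hi}" by (auto simp: \<B>_def)
    then show "(\<Sum>s\<in>B. p s * (s - x)) + Min (insert 1 (d ` \<B>)) \<le> call_potential \<nu> x"
      using d(2)[of B x] Min_le[OF fin, of "d B"] by auto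
  qed
qed

text \<open>
  The constants are chosen in this order: bounds \<open>lo\<close>, \<open>hi\<close> for the quantile \<open>x'\<close> in the middle of the
  gap, the slack \<open>\<delta>\<close> of the strict inequality on \<open>[lo, hi]\<close>, a truncation level \<open>K\<close> at which the tail of \<open>\<nu>\<close> costs
  less than \<open>\<delta> / 2\<close>, and finally a gap \<open>R\<close> so wide that large values of \<open>\<bar>Y\<bar>\<close> cost less than \<open>\<delta> / 2\<close>.
\<close>

lemma separated_avg_too_large:
  assumes strict: "\<And>B x. B \<subseteq> S \<Longrightarrow> B \<noteq> {} \<Longrightarrow> B \<noteq> S \<Longrightarrow>
      (\<Sum>s\<in>B. p s * (s - x)) < call_potential \<nu> x"
  obtains R where "0 < R"
    "\<And>a B c. B \<subseteq> S \<Longrightarrow> B \<noteq> {} \<Longrightarrow> B \<noteq> S \<Longrightarrow> (\<And>s. s \<in> B \<Longrightarrow> c + R < a s) \<Longrightarrow>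
      (\<And>s. s \<in> S - B \<Longrightarrow> a s \<le> c) \<Longrightarrow> (\<Sum>s\<in>B. p s * s) < (\<Sum>s\<in>B. p s * avg a s)"
proof -
  define m where "m = Min (insert 1 (p ` S))"
  have m_le: "m \<le> p s" if "s \<in> S" for s using that finite_S by (simp add: m_def)
  have m_pos: "0 < m" using finite_S atom_pos by (auto simp: m_def)
  have m_le1: "m \<le> 1" using finite_S by (simp add: m_def)
  define lo where "lo = quant \<nu> (m / 2)"
  define hi where "hi = quant \<nu> (1 - m / 2)"
  have "lo \<le> hi" unfolding lo_def hi_def using m_pos m_le1 by (intro nu.quant_mono) auto
  obtain \<delta> where \<delta>: "0 < \<delta>"
    "\<And>B x. B \<subseteq> S \<Longrightarrow> B \<noteq> {} \<Longrightarrow> B \<noteq> S \<Longrightarrow> lo \<le> x \<Longrightarrow> x \<le> hi \<Longrightarrow>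
      (\<Sum>s\<in>B. p s * (s - x)) + \<delta> \<le> call_potential \<nu> x"
    by (rule uniform_slack[OF strict \<open>lo \<le> hi\<close>]) blast+
  define H where "H = \<bar>lo\<bar> + \<bar>hi\<bar>"
  have "\<forall>\<^sub>F n in sequentially. (\<integral>z. max (\<bar>z\<bar> - real n) 0 \<partial>\<nu>) < \<delta> / 2"
    using \<delta>(1) by (intro order_tendstoD(2)[OF nu.tail_integral_tendsto_0[OF integrable_nu]]) simp
  then obtain K :: nat where K: "(\<integral>z. max (\<bar>z\<bar> - real K) 0 \<partial>\<nu>) < \<delta> / 2"
    by (auto dest: eventually_happens)
  have half: "LIM r at_top. r / 2 :: real :> at_top"
    using filterlim_at_top_mult_tendsto_pos[OF tendsto_const[of "1 / 2 :: real"] _ filterlim_ident] by simp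
  have top: "((\<lambda>r. cdf q (r / 2)) \<longlongrightarrow> 1) at_top"
    by (rule filterlim_compose[OF qd.cdf_lim_at_top_prob half])
  have bot: "((\<lambda>r. cdf q (- (r / 2))) \<longlongrightarrow> 0) at_top"
    by (rule filterlim_compose[OF qd.cdf_lim_at_bot filterlim_compose[OF filterlim_uminus_at_bot_at_top half]])
  have err: "((\<lambda>r. (K + H) * (cdf q (- (r / 2)) + 1 - cdf q (r / 2))) \<longlongrightarrow> (K + H) * (0 + 1 - 1)) at_top"
    by (intro tendsto_intros top bot)
  have "\<forall>\<^sub>F r in at_top. 0 < r \<and> 1 / 2 < cdf q (r / 2) \<and> cdf q (- (r / 2)) < 1 / 2 \<and>
      (K + H) * (cdf q (- (r / 2)) + 1 - cdf q (r / 2)) < \<delta> / 2"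
    using \<delta>(1) by (intro eventually_conj order_tendstoD(1)[OF top] order_tendstoD(2)[OF bot]
        order_tendstoD(2)[OF err] eventually_gt_at_top) auto
  then obtain R where R: "0 < R" "1 / 2 < cdf q (R / 2)" "cdf q (- (R / 2)) < 1 / 2"
      "(K + H) * (cdf q (- (R / 2)) + 1 - cdf q (R / 2)) < \<delta> / 2"
    by (auto dest: eventually_happens)
  show ?thesis
  proof (rule that[OF R(1)])
    fix a B c
    assume B: "B \<subseteq> S" "B \<noteq> {}" "B \<noteq> S"
      and c: "\<And>s. s \<in> B \<Longrightarrow> c + R < a s" "\<And>s. s \<in> S - B \<Longrightarrow> a s \<le> c"
    define x' where "x' = terminal a (c + R / 2)"
    have level: "m / 2 \<le> cdf (bass_law a \<star> q) (c + R / 2)" "cdf (bass_law a \<star> q) (c + R / 2) \<le> 1 - m / 2"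
      using separated_level_bounds[OF c B _ _ m_le] R by auto
    have x': "lo \<le> x'" "x' \<le> hi"
      unfolding x'_def terminal_def lo_def hi_def using level m_pos by (auto intro!: nu.quant_mono)
    have "call_potential \<nu> x' \<le> (\<Sum>s\<in>B. p s * (avg a s - x'))
      + (K + H) * (cdf q (- (R / 2)) + 1 - cdf q (R / 2)) + (\<integral>z. max (\<bar>z\<bar> - K) 0 \<partial>\<nu>)"
      by (rule avg_of_separated[OF c B(1) x'_def]) (use level m_pos x' in \<open>auto simp: H_def\<close>)
    with \<delta>(2)[OF B x'] K R(4)
    have "(\<Sum>s\<in>B. p s * (s - x')) < (\<Sum>s\<in>B. p s * (avg a s - x'))" by linarith
    then show "(\<Sum>s\<in>B. p s * s) < (\<Sum>s\<in>B. p s * avg a s)"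
      by (simp add: right_diff_distrib sum_subtractf)
  qed
qed

text \<open>
  If positions at both faces \<open>0\<close> and \<open>L\<close> occurred, a gap would be forced by the pigeonhole
  principle, and the atoms above it, all at positive positions, would satisfy \<open>avg a s \<le> s\<close>, contrary to
  \<open>separated_avg_too_large\<close>. With one face avoided, all \<open>avg a s - s\<close> have one sign, and their weighted
  sum vanishes.
\<close>

lemma exists_positions:
  assumes strict: "\<And>B x. B \<subseteq> S \<Longrightarrow> B \<noteq> {} \<Longrightarrow> B \<noteq> S \<Longrightarrow>
      (\<Sum>s\<in>B. p s * (s - x)) < call_potential \<nu> x"
    and mean: "(\<Sum>s\<in>S. p s * s) = (\<integral>z. z \<partial>\<nu>)"
  obtains a where "\<And>s. s \<in> S \<Longrightarrow> avg a s = s"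
proof -
  obtain R where R: "0 < R"
    "\<And>a B c. B \<subseteq> S \<Longrightarrow> B \<noteq> {} \<Longrightarrow> B \<noteq> S \<Longrightarrow> (\<And>s. s \<in> B \<Longrightarrow> c + R < a s) \<Longrightarrow>
      (\<And>s. s \<in> S - B \<Longrightarrow> a s \<le> c) \<Longrightarrow> (\<Sum>s\<in>B. p s * s) < (\<Sum>s\<in>B. p s * avg a s)"
    by (rule separated_avg_too_large[OF strict]) blast+
  define L where "L = card S * R"
  have "0 \<le> L" using R(1) by (simp add: L_def)
  obtain a where a: "\<And>i. i \<in> S \<Longrightarrow> 0 \<le> a i" "\<And>i. i \<in> S \<Longrightarrow> a i \<le> L"
    "\<And>i. i \<in> S \<Longrightarrow> 0 < a i \<Longrightarrow> avg a i \<le> i" "\<And>i. i \<in> S \<Longrightarrow> a i < L \<Longrightarrow> i \<le> avg a i"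
    by (rule box_complementarity[where e=avg and x="\<lambda>i. i", OF finite_S \<open>0 \<le> L\<close> avg_antimono avg_tendsto])
      blast+
  have total: "(\<Sum>s\<in>S. p s * (avg a s - s)) = 0"
    using sum_avg[of a] mean by (simp add: right_diff_distrib sum_subtractf)
  have "(\<forall>i\<in>S. a i \<noteq> 0) \<or> (\<forall>i\<in>S. a i \<noteq> L)"
  proof (rule ccontr)
    assume "\<not> ?thesis"
    then obtain i j where i: "i \<in> S" "a i = 0" and j: "j \<in> S" "a j = card S * R"
      by (auto simp: L_def)
    obtain c where c: "0 \<le> c" "c < card S * R" "\<And>k. k \<in> S \<Longrightarrow> a k \<le> c \<or> c + R < a k"
      by (rule exists_gap[OF finite_S R(1) i j]) blast
    define B where "B = {k\<in>S. c + R < a k}"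
    have "j \<in> B" using j c(2) c(3)[OF j(1)] by (auto simp: B_def)
    moreover have "i \<notin> B" using i c(1) R(1) by (simp add: B_def)
    ultimately have "(\<Sum>s\<in>B. p s * s) < (\<Sum>s\<in>B. p s * avg a s)"
      using i(1) c(3) by (intro R(2)[of B c a]) (auto simp: B_def)
    moreover have "(\<Sum>s\<in>B. p s * avg a s) \<le> (\<Sum>s\<in>B. p s * s)"
      using a(3) c(1) R(1) by (intro sum_mono mult_left_mono) (auto simp: B_def)
    ultimately show False by simp
  qed
  then have "\<forall>s\<in>S. avg a s = s"
  proof
    assume "\<forall>i\<in>S. a i \<noteq> 0"
    then have "avg a s \<le> s" if "s \<in> S" for s using a(1,3)[OF that] that by force
    then have nn: "0 \<le> p s * (s - avg a s)" if "s \<in> S" for s using that by simp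
    have "(\<Sum>s\<in>S. p s * (s - avg a s)) = 0"
      using total by (simp add: right_diff_distrib sum_subtractf)
    then have "\<forall>s\<in>S. p s * (s - avg a s) = 0" using nn finite_S by (simp add: sum_nonneg_eq_0_iff)
    then show ?thesis using atom_pos by fastforce
  next
    assume "\<forall>i\<in>S. a i \<noteq> L"
    then have "s \<le> avg a s" if "s \<in> S" for s using a(2,4)[OF that] that by force
    then have nn: "0 \<le> p s * (avg a s - s)" if "s \<in> S" for s using that by simp
    have "\<forall>s\<in>S. p s * (avg a s - s) = 0" using nn finite_S total by (simp add: sum_nonneg_eq_0_iff)
    then show ?thesis using atom_pos by fastforce
  qed
  then show ?thesis using that by blast
qed

end

section \<open>The martingale coupling\<close>

context finite_bass
begin

text \<open>
  Once the averages are the original atoms, \<open>M\<^sub>0\<close> is almost surely the atom that was moved, so \<open>\<pi>\<close> is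
  the law of \<open>(s, T (a s + Y))\<close> under \<open>\<mu> \<otimes> q\<close>. From this form the marginals, the disintegration
  \<open>s \<mapsto> law(T (a s + Y))\<close> and the martingale property can be read off.
\<close>

lemma bass_martingale_of_positions:
  assumes a: "\<And>s. s \<in> S \<Longrightarrow> avg a s = s"
  shows "\<exists>\<pi>. q_bass_martingale q \<mu> \<nu> \<pi>"
proof -
  define T where "T = bass_map q \<nu> (bass_law a)"
  have T_real: "real_of_ereal (T z) = terminal a z" for z
    by (simp add: T_def bass_map_def terminal_def quant_def)
  have avg_a: "bass_avg q T (a s) = s" if "s \<in> S" for s
    using a[OF that] by (simp add: bass_avg_def T_real avg_def)
  have [measurable]: "bass_avg q T \<in> borel_measurable borel"
    unfolding bass_avg_def[abs_def] T_real by measurable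
  define \<pi> where "\<pi> = distr (bass_law a \<Otimes>\<^sub>M q) (borel \<Otimes>\<^sub>M borel)
           (\<lambda>(x, y). (bass_avg q T x, real_of_ereal (T (x + y))))"
  have \<pi>: "\<pi> = distr (\<mu> \<Otimes>\<^sub>M q) (borel \<Otimes>\<^sub>M borel) (\<lambda>(x, y). (x, terminal a (place a x + y)))"
  proof -
    have "\<pi> = distr (\<mu> \<Otimes>\<^sub>M q) (borel \<Otimes>\<^sub>M borel)
        (\<lambda>w. (bass_avg q T (place a (fst w)), terminal a (place a (fst w) + snd w)))"
      unfolding \<pi>_def bass_law_pair T_real by (subst distr_distr) (auto simp: o_def case_prod_beta')
    also have "\<dots> = distr (\<mu> \<Otimes>\<^sub>M q) (borel \<Otimes>\<^sub>M borel) (\<lambda>(x, y). (x, terminal a (place a x + y)))"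
    proof (rule distr_cong_AE)
      have "AE w in \<mu> \<Otimes>\<^sub>M q. bass_avg q T (place a (fst w)) = fst w"
      proof (rule pair.AE_pair_measure)
        show "AE x in \<mu>. AE y in q. bass_avg q T (place a (fst (x, y))) = fst (x, y)"
          unfolding AE_mu_iff by (simp add: avg_a)
      qed measurable
      then show "AE w in \<mu> \<Otimes>\<^sub>M q. (bass_avg q T (place a (fst w)), terminal a (place a (fst w) + snd w))
          = (case w of (x, y) \<Rightarrow> (x, terminal a (place a x + y)))"
        by eventually_elim (simp add: case_prod_beta')
    qed (simp_all add: case_prod_beta')
    finally show ?thesis .
  qed
  define K where "K x = distr q borel (\<lambda>y. terminal a (place a x + y))" for x
  have "\<pi> \<in> martingale_couplings \<mu> \<nu>"
    unfolding martingale_couplings_def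
  proof (intro CollectI conjI exI[of _ K] ballI)
    show "prob_space \<pi>" unfolding \<pi> by (rule pair.prob_space_distr) measurable
    show "sets \<pi> = sets (borel \<Otimes>\<^sub>M borel)" by (simp add: \<pi>)
    have "distr \<pi> borel fst = distr (\<mu> \<Otimes>\<^sub>M q) borel fst"
      unfolding \<pi> by (subst distr_distr) (auto simp: o_def case_prod_beta')
    also have "\<dots> = distr (\<mu> \<Otimes>\<^sub>M q) \<mu> fst" by (rule distr_cong) auto
    also have "\<dots> = \<mu>" by (rule qd.distr_pair_fst)
    finally show "distr \<pi> borel fst = \<mu>" .
    have "distr \<pi> borel snd = distr (\<mu> \<Otimes>\<^sub>M q) borel (\<lambda>(x, y). terminal a (place a x + y))"
      unfolding \<pi> by (subst distr_distr) (auto simp: o_def case_prod_beta')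
    also have "\<dots> = distr (bass_law a \<star> q) borel (terminal a)"
      unfolding convolution_eq_distr by (subst distr_distr) (auto simp: o_def case_prod_beta')
    finally show "distr \<pi> borel snd = \<nu>" by (simp add: distr_terminal)
    have q_prob: "q \<in> space (prob_algebra borel)"
      by (simp add: space_prob_algebra qd.prob_space_axioms)
    show "K \<in> borel \<rightarrow>\<^sub>M prob_algebra borel"
      unfolding K_def
      by (rule measurable_distr_prob_space2[where g="\<lambda>_. q" and M=borel])
        (use q_prob in \<open>auto simp: case_prod_beta'\<close>)
    show "emeasure \<pi> (A \<times> B) = (\<integral>\<^sup>+x\<in>A. emeasure (K x) B \<partial>\<mu>)"
      if [measurable]: "A \<in> sets borel" "B \<in> sets borel" for A B
    proof -
      have "emeasure \<pi> (A \<times> B) = (\<integral>\<^sup>+w. indicator (A \<times> B) w \<partial>\<pi>)"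
        by (subst nn_integral_indicator) (auto simp: \<pi>)
      also have "\<dots> = (\<integral>\<^sup>+w. indicator A (fst w) * indicator B (terminal a (place a (fst w) + snd w)) \<partial>(\<mu> \<Otimes>\<^sub>M q))"
        unfolding \<pi> by (subst nn_integral_distr) (auto simp: case_prod_beta' indicator_times)
      also have "\<dots> = (\<integral>\<^sup>+x. \<integral>\<^sup>+y. indicator A x * indicator B (terminal a (place a x + y)) \<partial>q \<partial>\<mu>)"
        by (subst qd.nn_integral_fst[symmetric]) auto
      also have "\<dots> = (\<integral>\<^sup>+x\<in>A. emeasure (K x) B \<partial>\<mu>)"
      proof (rule nn_integral_cong)
        fix x
        have "emeasure (K x) B = (\<integral>\<^sup>+y. indicator B y \<partial>K x)"
          by (subst nn_integral_indicator) (auto simp: K_def)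
        also have "\<dots> = (\<integral>\<^sup>+y. indicator B (terminal a (place a x + y)) \<partial>q)"
          unfolding K_def by (subst nn_integral_distr) auto
        finally show "(\<integral>\<^sup>+y. indicator A x * indicator B (terminal a (place a x + y)) \<partial>q)
            = emeasure (K x) B * indicator A x"
          by (subst nn_integral_cmult) (auto simp: mult.commute)
      qed
      finally show ?thesis .
    qed
    show "AE x in \<mu>. integrable (K x) (\<lambda>y. y) \<and> (\<integral>y. y \<partial>K x) = x"
      unfolding AE_mu_iff
    proof
      fix s assume s: "s \<in> S"
      show "integrable (K s) (\<lambda>y. y) \<and> (\<integral>y. y \<partial>K s) = s"
        using integrable_terminal[OF s, of a] a[OF s] s
        by (simp add: K_def integrable_distr_eq integral_distr avg_def)
    qed
  qed
  moreover have "bass_measure q \<nu> \<pi> (bass_law a)"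
    unfolding bass_measure_def T_def[symmetric]
  proof (intro conjI bexI[of _ "a ` S"])
    show "real_distribution (bass_law a)" by (rule bass_law.real_distribution_axioms)
    show "\<pi> = distr (bass_law a \<Otimes>\<^sub>M q) (borel \<Otimes>\<^sub>M borel)
           (\<lambda>(x, y). (bass_avg q T x, real_of_ereal (T (x + y))))" by (rule \<pi>_def)
    show aS [measurable]: "a ` S \<in> sets borel"
      using finite_S by (auto intro: borel_closed finite_imp_closed)
    have "AE x in \<mu>. place a x \<in> a ` S" unfolding AE_mu_iff by simp
    then have "AE x in bass_law a. x \<in> a ` S"
      unfolding bass_law_def by (subst AE_distr_iff) auto
    then show "measure (bass_law a) (a ` S) = 1"
      using aS by (subst (asm) bass_law.AE_in_set_eq_1) auto
    show "\<forall>x\<in>a ` S. bass_avg_defined q T x"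
    proof
      fix x assume "x \<in> a ` S"
      then obtain s where s: "s \<in> S" "x = a s" by auto
      have "AE y in q. \<bar>T (a s + y)\<bar> \<noteq> \<infinity>"
        using AE_level_01[OF s(1), of a]
        by eventually_elim (simp add: T_def bass_map_def nu.quantile_eq_quant)
      then show "bass_avg_defined q T x"
        unfolding bass_avg_defined_def T_real s(2) using integrable_terminal[OF s(1)] by simp
    qed
    show "strict_mono_on (a ` S) (bass_avg q T)"
    proof (rule strict_mono_onI)
      fix x y assume "x \<in> a ` S" "y \<in> a ` S" and less: "x < y"
      then obtain s t where s: "s \<in> S" "x = a s" and t: "t \<in> S" "y = a t" by auto
      have "AE y in q. terminal a (a s + y) \<le> terminal a (a t + y)"
        using AE_level_01[OF s(1), of a] AE_level_01[OF t(1), of a]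
      proof eventually_elim
        case (elim z)
        then show ?case unfolding terminal_def using less s t
          by (intro nu.quant_mono convolution.cdf_nondecreasing) auto
      qed
      then have "avg a s \<le> avg a t"
        unfolding avg_def by (intro integral_mono_AE integrable_terminal s t)
      \<comment> \<open>The averages are weakly increasing because \<open>T\<close> is; distinct positions carry distinct atoms.\<close>
      moreover have "s \<noteq> t" using less s t by auto
      ultimately show "bass_avg q T x < bass_avg q T y"
        using a[OF s(1)] a[OF t(1)] avg_a[OF s(1)] avg_a[OF t(1)] s t by simp
    qed
  qed
  ultimately show ?thesis unfolding q_bass_martingale_def by blast
qed

end

theorem theorem1p9:
  fixes \<mu> \<nu> q :: "real measure"
  assumes "real_distribution \<mu>" and "real_distribution \<nu>" and "real_distribution q"
    and "integrable \<mu> (\<lambda>x. x)" and "integrable \<nu> (\<lambda>x. x)"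
    and "absolutely_continuous lborel q"
    and "irreducible_pair \<mu> \<nu>"
    and "\<exists>S. finite S \<and> measure \<mu> S = 1"
  shows "\<exists>\<pi>. q_bass_martingale q \<mu> \<nu> \<pi>"
proof -
  interpret mu: real_distribution \<mu> by fact
  obtain S0 where S0: "finite S0" "measure \<mu> S0 = 1" using assms(8) by auto
  \<comment> \<open>Points of the given set that carry no mass are not atoms.\<close>
  define S where "S = {s\<in>S0. 0 < measure \<mu> {s}}"
  have S: "finite S" using S0(1) by (simp add: S_def)
  have "measure \<mu> S0 = (\<Sum>s\<in>S0. measure \<mu> {s})"
    using S0(1) by (intro mu.finite_measure_eq_sum_singleton) auto
  also have "\<dots> = (\<Sum>s\<in>S. measure \<mu> {s})"
    using S0(1) by (intro sum.mono_neutral_right) (auto simp: S_def zero_less_measure_iff)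
  also have "\<dots> = measure \<mu> S"
    using S by (intro mu.finite_measure_eq_sum_singleton[symmetric]) auto
  finally have mu_S: "measure \<mu> S = 1" using S0(2) by simp
  have atomless: "measure q {x} = 0" for x
  proof -
    have "{x} \<in> null_sets lborel" by (simp add: null_sets_def)
    then have "{x} \<in> null_sets q" using assms(6) by (auto simp: absolutely_continuous_def)
    then show ?thesis by (auto simp: measure_def)
  qed
  interpret finite_bass \<mu> \<nu> q S
    by (intro finite_bass.intro finite_bass_axioms.intro)
      (use assms(1,2,3,5) S mu_S atomless in \<open>auto simp: cdf_distribution_def S_def\<close>)
  obtain a where "\<And>s. s \<in> S \<Longrightarrow> avg a s = s"
    by (rule exists_positions[OF irreducible_strict irreducible_mean]) (use assms(7) in blast)+
  then show ?thesis by (rule bass_martingale_of_positions)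
qed

end
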